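(* (i) For $d\ge3$, $R_{\rm gs}(d,\mathbb{S}^{d-1})=\arccos\frac{1}{\sqrt d}$, and a family of $d$ $(d-2)$-dimensional great spheres is $d$-extremal in $\mathbb{S}^{d-1}$ if and only if it consists of mutually orthogonal $(d-2)$-dimensional great spheres. (ii) $\arcsin\left(\frac{d}{2\sum_{i=0}^{d-1}\binom{n-1}{i}}\right)<R_{\rm gs}(n,\mathbb{S}^{d-1})$ holds for $n>d>3$. (iii) $R_{\rm gs}(n,\mathbb{S}^{d-1})\le\arcsin\left(\frac{4}{\sqrt[d]{n}}\cdot\sqrt{\frac{2d-2}{d}}\right)$ holds for any $n>d\ge3$.
   Context: $\mathbb{S}^{d-1}$ is the unit sphere centered at the origin of Euclidean $d$-space $\mathbb{E}^d$. A $k$-dimensional great sphere of $\mathbb{S}^{d-1}$ is the intersection of $\mathbb{S}^{d-1}$ with a $(k+1)$-dimensional linear subspace of $\mathbb{E}^d$; two $(d-2)$-dimensional great spheres are orthogonal if the hyperplanes spanned by them are. The (closed) spherical cap of center $\mathbf{x}\in\mathbb{S}^{d-1}$ and angular radius $\alpha\in(0,\frac{\pi}{2}]$ is $\{\mathbf{y}\in\mathbb{S}^{d-1}:\langle\mathbf{x},\mathbf{y}\rangle\ge\cos\alpha\}$. Finitely many $(d-2)$-dimensional great spheres generate a tiling of $\mathbb{S}^{d-1}$ whose $(d-1)$-dimensional cells are the closures of the connected components of the complement of their union. For $d\ge 3$ and $n>1$, $R_{\rm gs}(n,\mathbb{S}^{d-1})$ denotes the smallest $R>0$ such that there exists an arrangement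 of $n$ $(d-2)$-dimensional great spheres in $\mathbb{S}^{d-1}$ with the property that each $(d-1)$-dimensional cell of the tiling generated by them can be covered by a spherical cap of radius $R$. An arrangement of $n$ $(d-2)$-dimensional great spheres is called $n$-extremal if each $(d-1)$-dimensional cell of the tiling generated by them can be covered by a spherical cap of radius $R_{\rm gs}(n,\mathbb{S}^{d-1})$.
   Formalization: In (iii) the argument of arcsin is capped at 1, since for small n (e.g. d = 3, n = 4, where it is about 2.91) it exceeds 1 and the printed bound is undefined; there the bound is read as π/2. *)

theory Defs
  imports "HOL-Analysis.Analysis"
begin

text \<open>The unit sphere is \<open>sphere 0 1\<close> in a type \<open>'a :: euclidean_space\<close>, whose dimension
  \<open>d\<close> is \<open>DIM('a)\<close>.\<close>

definition great_sphere :: "nat \<Rightarrow> 'a::euclidean_space set \<Rightarrow> bool" where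
  "great_sphere k G \<longleftrightarrow> (\<exists>V. subspace V \<and> dim V = k + 1 \<and> G = sphere 0 1 \<inter> V)"

text \<open>Two hyperplanes are orthogonal when their normal vectors are.  A great sphere is not
  orthogonal to itself, so a family of mutually orthogonal ones is one on which this relation
  holds \<open>pairwise\<close>.\<close>

definition orthogonal_great_spheres :: "'a::euclidean_space set \<Rightarrow> 'a set \<Rightarrow> bool" where
  "orthogonal_great_spheres G H \<longleftrightarrow>
     (\<forall>u\<in>orthogonal_comp (span G). \<forall>v\<in>orthogonal_comp (span H). orthogonal u v)"

definition spherical_cap :: "'a::euclidean_space \<Rightarrow> real \<Rightarrow> 'a set" where
  "spherical_cap x \<alpha> = {y \<in> sphere 0 1. x \<bullet> y \<ge> cos \<alpha>}"

definition gs_arrangement :: "nat \<Rightarrow> 'a::euclidean_space set set \<Rightarrow> bool" where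
  "gs_arrangement n \<A> \<longleftrightarrow>
     finite \<A> \<and> card \<A> = n \<and> (\<forall>G\<in>\<A>. great_sphere (DIM('a) - 2) G)"

text \<open>The sphere is closed, so closures in the ambient space and in the sphere agree.\<close>

definition cells :: "'a::euclidean_space set set \<Rightarrow> 'a set set" where
  "cells \<A> = closure ` components (sphere 0 1 - \<Union>\<A>)"

definition cells_covered :: "'a::euclidean_space set set \<Rightarrow> real \<Rightarrow> bool" where
  "cells_covered \<A> R \<longleftrightarrow> (\<forall>C\<in>cells \<A>. \<exists>x\<in>sphere 0 1. C \<subseteq> spherical_cap x R)"

text \<open>The type argument fixes the ambient space.  \<open>LEAST\<close> demands an attained minimum.  The
  bound \<open>R \<le> pi / 2\<close> is the range of radii for which spherical caps are considered.\<close>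

definition R_gs :: "'a::euclidean_space itself \<Rightarrow> nat \<Rightarrow> real" where
  "R_gs E n = (LEAST R. 0 < R \<and> R \<le> pi / 2 \<and>
     (\<exists>\<A> :: 'a set set. gs_arrangement n \<A> \<and> cells_covered \<A> R))"

definition gs_extremal :: "nat \<Rightarrow> 'a::euclidean_space set set \<Rightarrow> bool" where
  "gs_extremal n \<A> \<longleftrightarrow> gs_arrangement n \<A> \<and> cells_covered \<A> (R_gs TYPE('a) n)"

end

theory Submission
  imports Defs
begin

text \<open>
  A great sphere of codimension one is given by a normal vector, and the cells of an arrangement are
  the nonempty sets on which the signs of the inner products with all normals are prescribed.  A cell is
  covered by a cap of radius \<open>R\<close> iff some unit vector \<open>c\<close> satisfies \<open>c \<bullet> x \<ge> cos R\<close> on this set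
  (\<open>cells_covered_iff\<close>).  In this form all parts are statements about inner products.

  For \<open>n = d\<close> the cells are simplices with vertices \<open>\<delta> i *\<^sub>R v i\<close>, one simplex for each sign vector
  \<open>\<delta>\<close>.  Summing the cap inequality over the vertices gives \<open>d * cos R \<le> norm (\<Sum>i. \<delta> i *\<^sub>R v i)\<close>.  A
  greedy choice of signs makes this norm at most \<open>sqrt d\<close>, strictly less if two of the \<open>v i\<close> are not
  orthogonal.  Hence \<open>cos R \<le> 1 / sqrt d\<close>, with equality only for orthogonal great spheres; and the
  cells of an orthogonal arrangement are orthants, which are covered by caps of this radius around their
  barycentres.

  For general \<open>n\<close> the minimal radius is attained, because the space of unit normals is compact and
  great spheres that merge in the limit can be replaced by any others without enlarging the cells
  (\<open>least_covering_radius\<close>).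

  The lower bound comes from a single great circle.  In general position it meets each of the \<open>n\<close>
  great spheres in two antipodal points, so some cell contains an arc of length at least
  \<open>pi / (n + 1)\<close>, and \<open>R \<ge> pi / (2 * (n + 1)) \<ge> arcsin (1 / (n + 1))\<close> (\<open>cap_radius_lower_bound\<close>).
  For \<open>n > d > 3\<close> the sum of binomial coefficients exceeds \<open>d * (n + 1) / 2\<close>, so that this is
  more than the bound in the theorem.

  For the upper bound the facets of a cube are divided by grids of mesh \<open>1 / m\<close> and projected to the
  sphere from its centre.  The grid lines are cut out by hyperplanes through the origin, about
  \<open>2 * m * d\<^sup>2\<close> of them, and two points of the same cell enclose an angle whose sine is at most
  \<open>sqrt (d - 1) / m\<close> (\<open>cells_covered_grid\<close>).  The number of hyperplanes is linear in \<open>m\<close>, whereas the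
  theorem allows a power \<open>d\<close>, which leaves room for the constants (\<open>grid_resolution_exists\<close>).
\<close>

section \<open>Great spheres and their normals\<close>

text \<open>The great spheres of codimension one, parametrised by a normal vector of their hyperplane.  The
  normal is left unnormalised, so that grids of hyperplanes can be written down directly.\<close>

definition equator :: "'a::euclidean_space \<Rightarrow> 'a set" where
  "equator u = {x \<in> sphere 0 1. u \<bullet> x = 0}"

lemma normalized_mem_equator:
  "x \<noteq> 0 \<Longrightarrow> u \<bullet> x = 0 \<Longrightarrow> x /\<^sub>R norm x \<in> equator u"
  by (simp add: equator_def)

lemma span_equator: "span (equator u) = {x. u \<bullet> x = 0}"
proof
  show "span (equator u) \<subseteq> {x. u \<bullet> x = 0}"
    by (rule span_minimal) (auto simp: equator_def subspace_hyperplane)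
  show "{x. u \<bullet> x = 0} \<subseteq> span (equator u)"
  proof
    fix x assume "x \<in> {x. u \<bullet> x = 0}"
    hence ux: "u \<bullet> x = 0" by simp
    show "x \<in> span (equator u)"
    proof (cases "x = 0")
      case False
      have "norm x *\<^sub>R (x /\<^sub>R norm x) \<in> span (equator u)"
        using normalized_mem_equator[OF False ux] by (intro span_scale span_base)
      thus ?thesis using False by simp
    qed (simp add: span_zero)
  qed
qed

lemma equator_scaleR: "c \<noteq> 0 \<Longrightarrow> equator (c *\<^sub>R u) = equator u"
  by (auto simp: equator_def)

lemma great_sphere_equator:
  fixes u :: "'a::euclidean_space"
  assumes "2 \<le> DIM('a)" "u \<noteq> 0"
  shows "great_sphere (DIM('a) - 2) (equator u)"
  unfolding great_sphere_def
proof (intro exI conjI)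
  show "subspace {x. u \<bullet> x = 0}" by (rule subspace_hyperplane)
  show "dim {x. u \<bullet> x = 0} = DIM('a) - 2 + 1" using assms by (simp add: dim_hyperplane)
  show "equator u = sphere 0 1 \<inter> {x. u \<bullet> x = 0}" by (auto simp: equator_def)
qed

lemma great_sphereE:
  fixes G :: "'a::euclidean_space set"
  assumes d: "2 \<le> DIM('a)" and G: "great_sphere (DIM('a) - 2) G"
  obtains u where "norm u = 1" "equator u = G"
proof -
  obtain V where V: "subspace V" "dim V = DIM('a) - 2 + 1" and GV: "G = sphere 0 1 \<inter> V"
    using G unfolding great_sphere_def by auto
  have "dim V < DIM('a)" using V d by simp
  then obtain w where w: "w \<noteq> 0" "\<And>y. y \<in> span V \<Longrightarrow> orthogonal w y"
    using orthogonal_to_subspace_exists by blast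
  have "V = {x. w \<bullet> x = 0}"
  proof (rule subspace_dim_equal)
    show "V \<subseteq> {x. w \<bullet> x = 0}" using w by (auto simp: orthogonal_def span_base)
    show "dim {x. w \<bullet> x = 0} \<le> dim V" using V d w by (simp add: dim_hyperplane)
  qed (use V in \<open>auto simp: subspace_hyperplane\<close>)
  hence "equator w = G" using GV by (auto simp: equator_def)
  hence "equator (w /\<^sub>R norm w) = G" using w by (simp add: equator_scaleR)
  moreover have "norm (w /\<^sub>R norm w) = 1" using w by simp
  ultimately show thesis using that by blast
qed

lemma gs_arrangement_normals:
  fixes \<A> :: "'a::euclidean_space set set"
  assumes d: "2 \<le> DIM('a)" and A: "gs_arrangement n \<A>"
  obtains u where "\<And>G. G \<in> \<A> \<Longrightarrow> norm (u G) = 1" "\<And>G. G \<in> \<A> \<Longrightarrow> equator (u G) = G"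
proof -
  have "\<forall>G\<in>\<A>. \<exists>u. norm u = 1 \<and> equator u = G"
    using A great_sphereE[OF d] unfolding gs_arrangement_def by metis
  thus thesis using that by metis
qed

text \<open>A vector orthogonal to every vector of the hyperplane is a multiple of its normal, because
  subtracting the component along the normal leaves a vector of the hyperplane that is orthogonal to
  itself.\<close>

lemma orthogonal_equators_iff:
  assumes "norm u = 1" "norm v = 1"
  shows "orthogonal_great_spheres (equator u) (equator v) \<longleftrightarrow> u \<bullet> v = 0"
proof -
  have normal_multiple: "\<exists>c. a = c *\<^sub>R w" if w: "norm w = 1" and a: "a \<in> orthogonal_comp (span (equator w))"
    for a w :: 'a
  proof -
    let ?y = "a - (w \<bullet> a) *\<^sub>R w"
    have ww: "w \<bullet> w = 1" using w by (simp add: dot_square_norm)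
    have wy: "w \<bullet> ?y = 0" using ww by (simp add: inner_diff_right)
    hence "?y \<bullet> a = 0" using a by (auto simp: span_equator orthogonal_comp_def orthogonal_def)
    hence "?y \<bullet> ?y = 0" using wy by (simp add: inner_diff_right inner_commute)
    thus ?thesis by (metis eq_iff_diff_eq_0 inner_eq_zero_iff)
  qed
  have normal_mem: "w \<in> orthogonal_comp (span (equator w))" for w :: 'a
    by (auto simp: span_equator orthogonal_comp_def orthogonal_def inner_commute)
  show ?thesis
  proof
    assume "orthogonal_great_spheres (equator u) (equator v)"
    thus "u \<bullet> v = 0" using normal_mem unfolding orthogonal_great_spheres_def orthogonal_def by blast
  next
    assume uv: "u \<bullet> v = 0"
    show "orthogonal_great_spheres (equator u) (equator v)"
      unfolding orthogonal_great_spheres_def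
    proof (intro ballI)
      fix a b assume "a \<in> orthogonal_comp (span (equator u))" "b \<in> orthogonal_comp (span (equator v))"
      then obtain c c' where "a = c *\<^sub>R u" "b = c' *\<^sub>R v"
        using normal_multiple assms by metis
      thus "orthogonal a b" using uv by (simp add: orthogonal_def)
    qed
  qed
qed

text \<open>Tilting the hyperplane orthogonal to a basis vector \<open>a\<close> towards another one, \<open>b\<close>: the hyperplane with
  normal \<open>a + t *\<^sub>R b\<close> contains \<open>b - t *\<^sub>R a\<close>, and no other one of this pencil does.\<close>

lemma infinite_equators:
  assumes d: "2 \<le> DIM('a::euclidean_space)"
  shows "infinite (equator ` {u :: 'a. u \<noteq> 0})"
proof -
  obtain a b :: 'a where ab: "a \<in> Basis" "b \<in> Basis" "a \<noteq> b"
    using d by (metis One_nat_def card_le_Suc0_iff_eq finite_Basis not_less_eq_eq numeral_2_eq_2)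
  hence ip: "a \<bullet> a = 1" "b \<bullet> b = 1" "a \<bullet> b = 0" "b \<bullet> a = 0" by (auto simp: inner_Basis)
  define w where "w t = a + t *\<^sub>R b" for t :: real
  define z where "z t = b - t *\<^sub>R a" for t :: real
  have wz: "w s \<bullet> z t = s - t" for s t
    by (simp add: w_def z_def inner_add_left inner_diff_right ip)
  have z0: "z t \<noteq> 0" for t using wz[of "t + 1" t] by auto
  have w0: "w t \<noteq> 0" for t using wz[of t "t - 1"] by auto
  have "inj (\<lambda>t. equator (w t))"
  proof (rule injI)
    fix s t assume eq: "equator (w s) = equator (w t)"
    have "z t /\<^sub>R norm (z t) \<in> equator (w s)"
      unfolding eq by (rule normalized_mem_equator[OF z0]) (simp add: wz)
    thus "s = t" using z0[of t] by (simp add: equator_def wz)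
  qed
  hence "infinite (range (\<lambda>t. equator (w t)))"
    using infinite_UNIV_char_0 finite_imageD by blast
  thus ?thesis by (rule infinite_super[rotated]) (use w0 in auto)
qed

section \<open>Cells as sign conditions\<close>

text \<open>The points of the sphere that lie, for every hyperplane, strictly on the same side as \<open>p\<close>.  Writing
  this with a product instead of signs keeps it an open condition in the point and in the normals.\<close>

definition chamber :: "('i \<Rightarrow> 'a::euclidean_space) \<Rightarrow> 'i set \<Rightarrow> 'a \<Rightarrow> 'a set" where
  "chamber u I p = {x \<in> sphere 0 1. \<forall>i\<in>I. 0 < (u i \<bullet> x) * (u i \<bullet> p)}"

lemma connected_subset_chamber:
  assumes T: "connected T" "p \<in> T" "T \<subseteq> sphere 0 1" and nz: "\<And>i x. i \<in> I \<Longrightarrow> x \<in> T \<Longrightarrow> u i \<bullet> x \<noteq> 0"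
  shows "T \<subseteq> chamber u I p"
proof
  fix x assume x: "x \<in> T"
  have "0 < (u i \<bullet> x) * (u i \<bullet> p)" if i: "i \<in> I" for i
  proof (rule ccontr)
    assume "\<not> 0 < (u i \<bullet> x) * (u i \<bullet> p)"
    hence "u i \<bullet> x \<le> 0 \<and> 0 \<le> u i \<bullet> p \<or> u i \<bullet> p \<le> 0 \<and> 0 \<le> u i \<bullet> x"
      by (auto simp: zero_less_mult_iff not_less)
    hence "\<exists>z\<in>T. u i \<bullet> z = 0"
      using connected_ivt_hyperplane[OF T(1)] x T(2) by blast
    thus False using nz[OF i] by blast
  qed
  thus "x \<in> chamber u I p" using x T(3) by (auto simp: chamber_def)
qed

text \<open>A chamber is the radial projection of an open convex cone, which avoids the origin as soon as there
  is a hyperplane.\<close>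

lemma connected_chamber:
  assumes "I \<noteq> {}"
  shows "connected (chamber u I p)"
proof -
  let ?K = "\<Inter>i\<in>I. {x. 0 < ((u i \<bullet> p) *\<^sub>R u i) \<bullet> x}"
  have K: "connected ?K" by (intro convex_connected convex_INT convex_halfspace_gt)
  have 0: "0 \<notin> ?K" using assms by auto
  have "chamber u I p = (\<lambda>x. x /\<^sub>R norm x) ` ?K"
  proof (intro equalityI subsetI)
    fix x assume "x \<in> chamber u I p"
    hence "x \<in> ?K" "x = x /\<^sub>R norm x" by (auto simp: chamber_def mult.commute)
    thus "x \<in> (\<lambda>x. x /\<^sub>R norm x) ` ?K" by blast
  next
    fix y assume "y \<in> (\<lambda>x. x /\<^sub>R norm x) ` ?K"
    then obtain x where x: "x \<in> ?K" and y: "y = x /\<^sub>R norm x" by blast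
    have x0: "x \<noteq> 0" using x 0 by metis
    have "0 < (u i \<bullet> y) * (u i \<bullet> p)" if "i \<in> I" for i
    proof -
      have "0 < (u i \<bullet> p) * (u i \<bullet> x)" using x that by auto
      hence "0 < ((u i \<bullet> p) * (u i \<bullet> x)) / norm x" using x0 by (intro divide_pos_pos) auto
      thus ?thesis using y by (simp add: divide_inverse mult_ac)
    qed
    thus "y \<in> chamber u I p" using y x0 by (simp add: chamber_def)
  qed
  moreover have "connected ((\<lambda>x. x /\<^sub>R norm x) ` ?K)"
    by (rule connected_continuous_image[OF _ K]) (intro continuous_intros, use 0 in auto)
  ultimately show ?thesis by simp
qed

lemma component_eq_chamber:
  assumes I: "I \<noteq> {}" and p: "norm p = 1" "\<And>i. i \<in> I \<Longrightarrow> u i \<bullet> p \<noteq> 0"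
  shows "connected_component_set (sphere 0 1 - (\<Union>i\<in>I. equator (u i))) p = chamber u I p"
    (is "connected_component_set ?S p = _")
proof
  have pS: "p \<in> ?S" using p by (auto simp: equator_def)
  show "connected_component_set ?S p \<subseteq> chamber u I p"
  proof (rule connected_subset_chamber)
    have "connected_component_set ?S p \<subseteq> ?S" by (rule connected_component_subset)
    thus "connected_component_set ?S p \<subseteq> sphere 0 1"
      and "\<And>i x. i \<in> I \<Longrightarrow> x \<in> connected_component_set ?S p \<Longrightarrow> u i \<bullet> x \<noteq> 0"
      by (auto simp: equator_def)
  qed (use pS in auto)
  show "chamber u I p \<subseteq> connected_component_set ?S p"
  proof (rule connected_component_maximal)
    show "p \<in> chamber u I p" using p by (auto simp: chamber_def zero_less_mult_iff linorder_neq_iff)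
    show "chamber u I p \<subseteq> ?S" by (auto simp: chamber_def equator_def)
  qed (rule connected_chamber[OF I])
qed

lemma closed_spherical_cap: "closed (spherical_cap c R)"
proof -
  have "spherical_cap c R = sphere 0 1 \<inter> {y. cos R \<le> c \<bullet> y}" by (auto simp: spherical_cap_def)
  thus ?thesis by (simp add: closed_Int closed_halfspace_ge)
qed

text \<open>The topological notion of a cell disappears here: cells are sign conditions, and closures can be
  dropped because caps are closed.  Everything below uses covering only in this form, which is about
  inner products.\<close>

lemma cells_covered_iff:
  fixes u :: "'i \<Rightarrow> 'a::euclidean_space"
  assumes "I \<noteq> {}"
  shows "cells_covered ((\<lambda>i. equator (u i)) ` I) R \<longleftrightarrow>
    (\<forall>p. norm p = 1 \<and> (\<forall>i\<in>I. u i \<bullet> p \<noteq> 0) \<longrightarrow>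
       (\<exists>c. norm c = 1 \<and> (\<forall>x\<in>chamber u I p. cos R \<le> c \<bullet> x)))"
proof -
  let ?S = "sphere 0 1 - (\<Union>i\<in>I. equator (u i))"
  have cl: "closure C \<subseteq> spherical_cap c R \<longleftrightarrow> C \<subseteq> spherical_cap c R" for C and c :: 'a
    using closure_minimal closed_spherical_cap closure_subset by (metis subset_trans)
  have "cells_covered ((\<lambda>i. equator (u i)) ` I) R \<longleftrightarrow>
      (\<forall>p\<in>?S. \<exists>c\<in>sphere 0 1. connected_component_set ?S p \<subseteq> spherical_cap c R)"
    by (simp add: cells_covered_def cells_def components_def cl)
  also have "\<dots> \<longleftrightarrow> (\<forall>p\<in>?S. \<exists>c\<in>sphere 0 1. chamber u I p \<subseteq> spherical_cap c R)"
  proof -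
    have "connected_component_set ?S p = chamber u I p" if "p \<in> ?S" for p
      using that by (intro component_eq_chamber[OF assms]) (auto simp: equator_def)
    thus ?thesis by simp
  qed
  also have "\<dots> \<longleftrightarrow> (\<forall>p. norm p = 1 \<and> (\<forall>i\<in>I. u i \<bullet> p \<noteq> 0) \<longrightarrow>
       (\<exists>c. norm c = 1 \<and> (\<forall>x\<in>chamber u I p. cos R \<le> c \<bullet> x)))"
  proof -
    have "p \<in> ?S \<longleftrightarrow> norm p = 1 \<and> (\<forall>i\<in>I. u i \<bullet> p \<noteq> 0)" for p
      by (auto simp: equator_def)
    moreover have "chamber u I p \<subseteq> spherical_cap c R \<longleftrightarrow> (\<forall>x\<in>chamber u I p. cos R \<le> c \<bullet> x)" for p c
      by (auto simp: chamber_def spherical_cap_def)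
    ultimately show ?thesis by (auto simp: Ball_def Bex_def)
  qed
  finally show ?thesis .
qed

text \<open>The cap condition is homogenised by the factor \<open>norm x\<close>, so that it becomes an inequality on the cone
  over the cell.  It then passes to boundary points, such as the vertices of the cell: move \<open>x\<close> by a
  small positive multiple of \<open>p\<close> into the open cone and let the multiple tend to \<open>0\<close>.\<close>

lemma cap_inequality_on_closed_cone:
  assumes cap: "\<And>x. x \<in> chamber u I p \<Longrightarrow> k \<le> c \<bullet> x"
    and p: "\<And>i. i \<in> I \<Longrightarrow> u i \<bullet> p \<noteq> 0"
    and x: "\<And>i. i \<in> I \<Longrightarrow> 0 \<le> (u i \<bullet> x) * (u i \<bullet> p)"
  shows "k * norm x \<le> c \<bullet> x"
proof -
  let ?y = "\<lambda>t. x + t *\<^sub>R p"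
  have "k * norm (?y t) \<le> c \<bullet> ?y t" if t: "0 < t" for t
  proof (cases "?y t = 0")
    case False
    have "0 < (u i \<bullet> ?y t) * (u i \<bullet> p)" if i: "i \<in> I" for i
    proof -
      have "0 < t * ((u i \<bullet> p) * (u i \<bullet> p))" using t p[OF i] by (auto simp: zero_less_mult_iff linorder_neq_iff)
      thus ?thesis using x[OF i] by (simp add: inner_add_right algebra_simps)
    qed
    hence "0 < ((u i \<bullet> ?y t) * (u i \<bullet> p)) / norm (?y t)" if i: "i \<in> I" for i
      using False i by (intro divide_pos_pos) auto
    hence "?y t /\<^sub>R norm (?y t) \<in> chamber u I p"
      using False by (simp add: chamber_def divide_inverse mult_ac)
    from cap[OF this] have "k \<le> (c \<bullet> ?y t) / norm (?y t)" by (simp add: divide_inverse mult.commute)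
    thus ?thesis using False by (simp add: pos_le_divide_eq)
  qed simp
  hence ev: "eventually (\<lambda>t. k * norm (?y t) \<le> c \<bullet> ?y t) (at_right 0)"
    by (simp add: eventually_at_right_less eventually_at_filter)
  have L: "((\<lambda>t. k * norm (?y t)) \<longlongrightarrow> k * norm (?y 0)) (at_right 0)"
    and R: "((\<lambda>t. c \<bullet> ?y t) \<longlongrightarrow> c \<bullet> ?y 0) (at_right 0)"
    by (intro tendsto_intros)+
  show ?thesis using tendsto_le[OF _ R L ev] by simp
qed

text \<open>Finitely many hyperplanes form a null set.\<close>

lemma exists_unit_vector_off_hyperplanes:
  fixes u :: "'i \<Rightarrow> 'a::euclidean_space"
  assumes "finite I" "\<And>i. i \<in> I \<Longrightarrow> u i \<noteq> 0"
  obtains p where "norm p = 1" "\<And>i. i \<in> I \<Longrightarrow> u i \<bullet> p \<noteq> 0"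
proof -
  have "negligible (insert 0 (\<Union>i\<in>I. {x. u i \<bullet> x = 0}))"
    using assms by (auto intro!: negligible_insert[THEN iffD2] negligible_hyperplane)
  hence "insert 0 (\<Union>i\<in>I. {x. u i \<bullet> x = 0}) \<noteq> UNIV" using non_negligible_UNIV by metis
  then obtain x where "x \<notin> insert 0 (\<Union>i\<in>I. {x. u i \<bullet> x = 0})" by blast
  hence "norm (x /\<^sub>R norm x) = 1" "\<And>i. i \<in> I \<Longrightarrow> u i \<bullet> (x /\<^sub>R norm x) \<noteq> 0" by auto
  thus thesis using that by blast
qed

section \<open>Arrangements of as many great spheres as the dimension\<close>

text \<open>The difference of both sides is orthogonal to all \<open>v i\<close>, and these span the space.\<close>

lemma orthonormal_expansion:
  fixes v :: "'i \<Rightarrow> 'a::euclidean_space"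
  assumes I: "finite I" "card I = DIM('a)"
    and v: "\<And>i. i \<in> I \<Longrightarrow> norm (v i) = 1" "\<And>i j. i \<in> I \<Longrightarrow> j \<in> I \<Longrightarrow> i \<noteq> j \<Longrightarrow> v i \<bullet> v j = 0"
  shows "(\<Sum>i\<in>I. (v i \<bullet> x) *\<^sub>R v i) = x"
proof -
  have vv: "v i \<bullet> v i = 1" if "i \<in> I" for i using v(1)[OF that] by (simp add: dot_square_norm)
  have inj: "inj_on v I"
  proof (rule inj_onI)
    fix i j assume "i \<in> I" "j \<in> I" "v i = v j"
    thus "i = j" using vv v(2) by (metis zero_neq_one)
  qed
  have "pairwise orthogonal (v ` I)"
    using v(2) by (fastforce simp: pairwise_def orthogonal_def)
  moreover have "0 \<notin> v ` I" using vv by force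
  ultimately have "independent (v ` I)" by (rule pairwise_orthogonal_independent)
  hence span: "span (v ` I) = UNIV"
    using card_ge_dim_independent[of "v ` I" UNIV] I inj by (auto simp: card_image)
  define w where "w = x - (\<Sum>i\<in>I. (v i \<bullet> x) *\<^sub>R v i)"
  have "orthogonal w y" if "y \<in> v ` I" for y
  proof -
    obtain k where k: "k \<in> I" "y = v k" using \<open>y \<in> v ` I\<close> by auto
    have "(\<Sum>i\<in>I. (v i \<bullet> x) *\<^sub>R v i) \<bullet> v k = (\<Sum>i\<in>I. (v i \<bullet> x) * (v i \<bullet> v k))"
      by (simp add: inner_sum_left)
    also have "\<dots> = (\<Sum>i\<in>I. if i = k then v k \<bullet> x else 0)"
      using v(2) vv k by (intro sum.cong) auto
    also have "\<dots> = v k \<bullet> x" using I k by simp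
    finally show ?thesis
      using k by (simp add: orthogonal_def w_def inner_diff_left inner_commute[of x])
  qed
  hence "orthogonal w w" using orthogonal_to_span[of w "v ` I" w] span by auto
  thus ?thesis by (simp add: orthogonal_self w_def)
qed

text \<open>The signs are chosen greedily: the next one makes the inner product with the current sum nonpositive,
  so that the squared norm grows by at most \<open>1\<close>.\<close>

lemma exists_signs_norm_sum_le:
  fixes v :: "'i \<Rightarrow> 'a::real_inner"
  assumes "finite J" "\<And>i. i \<in> J \<Longrightarrow> norm (v i) = 1"
  shows "\<exists>\<delta> :: 'i \<Rightarrow> real. (\<forall>i. \<bar>\<delta> i\<bar> = 1) \<and> (norm (s + (\<Sum>i\<in>J. \<delta> i *\<^sub>R v i)))\<^sup>2 \<le> (norm s)\<^sup>2 + card J"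
  using assms
proof (induction J rule: finite_induct)
  case empty
  show ?case by (intro exI[of _ "\<lambda>_. 1"]) simp
next
  case (insert k J)
  then obtain \<delta> :: "'i \<Rightarrow> real" where \<delta>: "\<And>i. \<bar>\<delta> i\<bar> = 1"
    and le: "(norm (s + (\<Sum>i\<in>J. \<delta> i *\<^sub>R v i)))\<^sup>2 \<le> (norm s)\<^sup>2 + card J" by auto
  define t where "t = s + (\<Sum>i\<in>J. \<delta> i *\<^sub>R v i)"
  define \<epsilon> :: real where "\<epsilon> = (if t \<bullet> v k \<le> 0 then 1 else - 1)"
  have e: "\<bar>\<epsilon>\<bar> = 1" "\<epsilon> * (t \<bullet> v k) \<le> 0" by (auto simp: \<epsilon>_def)
  have e2: "\<epsilon> * \<epsilon> = 1" by (simp add: \<epsilon>_def)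
  have vk: "v k \<bullet> v k = 1" using insert.prems[of k] by (simp add: dot_square_norm)
  have "(\<Sum>i\<in>insert k J. (\<delta>(k := \<epsilon>)) i *\<^sub>R v i) = \<epsilon> *\<^sub>R v k + (\<Sum>i\<in>J. \<delta> i *\<^sub>R v i)"
    using insert.hyps by (simp, intro sum.cong) auto
  hence "s + (\<Sum>i\<in>insert k J. (\<delta>(k := \<epsilon>)) i *\<^sub>R v i) = t + \<epsilon> *\<^sub>R v k"
    by (simp add: t_def)
  moreover have "(norm (t + \<epsilon> *\<^sub>R v k))\<^sup>2 = (norm t)\<^sup>2 + 2 * (\<epsilon> * (t \<bullet> v k)) + 1"
    using e2 vk by (simp add: power2_norm_eq_inner inner_add_left inner_add_right inner_commute
        mult.assoc[symmetric])
  moreover have "\<dots> \<le> (norm s)\<^sup>2 + card (insert k J)"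
    using e le insert.hyps unfolding t_def[symmetric] by simp
  ultimately have "(norm (s + (\<Sum>i\<in>insert k J. (\<delta>(k := \<epsilon>)) i *\<^sub>R v i)))\<^sup>2 \<le> (norm s)\<^sup>2 + card (insert k J)"
    by metis
  moreover have "\<forall>i. \<bar>(\<delta>(k := \<epsilon>)) i\<bar> = 1" using \<delta> e by simp
  ultimately show ?case by blast
qed

text \<open>If two of the vectors are not orthogonal, the greedy choice gains strictly when it starts with these
  two.\<close>

lemma exists_signs_norm_sum_less:
  fixes v :: "'i \<Rightarrow> 'a::real_inner"
  assumes I: "finite I" "\<And>i. i \<in> I \<Longrightarrow> norm (v i) = 1"
    and ab: "a \<in> I" "b \<in> I" "a \<noteq> b" "v a \<bullet> v b \<noteq> 0"
  shows "\<exists>\<delta> :: 'i \<Rightarrow> real. (\<forall>i. \<bar>\<delta> i\<bar> = 1) \<and> (norm (\<Sum>i\<in>I. \<delta> i *\<^sub>R v i))\<^sup>2 < card I"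
proof -
  define e where "e = - sgn (v a \<bullet> v b)"
  define s where "s = v a + e *\<^sub>R v b"
  have e: "\<bar>e\<bar> = 1" "e * (v a \<bullet> v b) < 0" "e * e = 1" using ab
    by (auto simp: e_def sgn_if split: if_splits)
  have "v a \<bullet> v a = 1" "v b \<bullet> v b = 1" using I(2) ab by (auto simp: dot_square_norm)
  hence "(norm s)\<^sup>2 = 2 + 2 * (e * (v a \<bullet> v b))"
    using e(3) by (simp add: s_def power2_norm_eq_inner inner_add_left inner_add_right inner_commute
        mult.assoc[symmetric])
  hence ns: "(norm s)\<^sup>2 < 2" using e(2) by simp
  have Ieq: "I = insert a (insert b (I - {a, b}))" using ab by auto
  have card: "card I = 2 + card (I - {a, b})"
    by (subst Ieq) (use ab I(1) in simp)
  obtain \<delta> :: "'i \<Rightarrow> real" where \<delta>: "\<And>i. \<bar>\<delta> i\<bar> = 1"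
    and le: "(norm (s + (\<Sum>i\<in>I - {a, b}. \<delta> i *\<^sub>R v i)))\<^sup>2 \<le> (norm s)\<^sup>2 + card (I - {a, b})"
    using exists_signs_norm_sum_le[of "I - {a, b}" v s] I by auto
  let ?\<delta> = "\<delta>(a := 1, b := e)"
  have "(\<Sum>i\<in>I. ?\<delta> i *\<^sub>R v i) = s + (\<Sum>i\<in>I - {a, b}. ?\<delta> i *\<^sub>R v i)"
    by (subst Ieq) (use ab I(1) in \<open>simp add: s_def\<close>)
  also have "(\<Sum>i\<in>I - {a, b}. ?\<delta> i *\<^sub>R v i) = (\<Sum>i\<in>I - {a, b}. \<delta> i *\<^sub>R v i)"
    by (rule sum.cong) auto
  finally have eq: "(\<Sum>i\<in>I. ?\<delta> i *\<^sub>R v i) = s + (\<Sum>i\<in>I - {a, b}. \<delta> i *\<^sub>R v i)" .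
  have "(norm (\<Sum>i\<in>I. ?\<delta> i *\<^sub>R v i))\<^sup>2 < card I" unfolding eq using le ns card by linarith
  thus ?thesis using \<delta> e by (intro exI[of _ ?\<delta>]) auto
qed

text \<open>As many hyperplanes as the dimension cut the sphere into simplices with vertices \<open>\<plusminus> v i\<close>, where
  \<open>v i\<close> spans the intersection of all hyperplanes but the \<open>i\<close>-th.  The simplices are given by the sign
  vectors \<open>\<delta>\<close>.  A cap that contains such a simplex has a centre \<open>c\<close> with \<open>c \<bullet> (\<delta> i *\<^sub>R v i) \<ge> cos R\<close>
  for all \<open>i\<close>; adding these inequalities bounds the norm of the sum of the vertices from below.\<close>

lemma simplex_vertices:
  fixes u :: "'i \<Rightarrow> 'a::euclidean_space"
  assumes I: "finite I" "card I = DIM('a)" "I \<noteq> {}" and u: "\<And>i. i \<in> I \<Longrightarrow> u i \<noteq> 0"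
    and cov: "cells_covered ((\<lambda>i. equator (u i)) ` I) R" and R: "0 < cos R"
  obtains v where "\<And>i. i \<in> I \<Longrightarrow> norm (v i) = 1"
    and "\<And>i j. i \<in> I \<Longrightarrow> j \<in> I \<Longrightarrow> u j \<bullet> v i = 0 \<longleftrightarrow> i \<noteq> j"
    and "\<And>\<delta>. (\<And>i. i \<in> I \<Longrightarrow> \<bar>\<delta> i\<bar> = 1) \<Longrightarrow> card I * cos R \<le> norm (\<Sum>i\<in>I. \<delta> i *\<^sub>R v i)"
proof -
  have cap: "\<exists>c. norm c = 1 \<and> (\<forall>x. (\<forall>i\<in>I. 0 \<le> (u i \<bullet> x) * (u i \<bullet> p)) \<longrightarrow> cos R * norm x \<le> c \<bullet> x)"
    if p: "\<And>i. i \<in> I \<Longrightarrow> u i \<bullet> p \<noteq> 0" for p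
  proof -
    have p0: "p \<noteq> 0" using p I(3) by auto
    hence "norm (p /\<^sub>R norm p) = 1" "\<forall>i\<in>I. u i \<bullet> (p /\<^sub>R norm p) \<noteq> 0" using p by auto
    then obtain c where c: "norm c = 1" "\<And>x. x \<in> chamber u I (p /\<^sub>R norm p) \<Longrightarrow> cos R \<le> c \<bullet> x"
      using cov unfolding cells_covered_iff[OF I(3)] by blast
    have "chamber u I (p /\<^sub>R norm p) = chamber u I p"
      using p0 by (simp add: chamber_def zero_less_mult_iff mult_less_0_iff)
    thus ?thesis using cap_inequality_on_closed_cone[of u I p "cos R" c] c p by auto
  qed
  \<comment> \<open>A common zero of the normals lies, together with its antipode, in the closure of every cell, and
    no cap of radius less than a right angle contains two antipodes.\<close>
  have common_zero: "x = 0" if x: "\<And>i. i \<in> I \<Longrightarrow> u i \<bullet> x = 0" for x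
  proof -
    obtain p where "\<And>i. i \<in> I \<Longrightarrow> u i \<bullet> p \<noteq> 0"
      using exists_unit_vector_off_hyperplanes[of I u, OF I(1) u] by blast
    then obtain c where c: "\<And>x. (\<forall>i\<in>I. 0 \<le> (u i \<bullet> x) * (u i \<bullet> p)) \<Longrightarrow> cos R * norm x \<le> c \<bullet> x"
      using cap by blast
    have "cos R * norm x \<le> c \<bullet> x" "cos R * norm (- x) \<le> c \<bullet> (- x)" by (rule c, simp add: x)+
    hence "cos R * norm x \<le> 0" by simp
    thus "x = 0" using R by (simp add: mult_le_0_iff)
  qed
  have "\<exists>w. norm w = 1 \<and> (\<forall>j\<in>I. u j \<bullet> w = 0 \<longleftrightarrow> i \<noteq> j)" if i: "i \<in> I" for i
  proof -
    have "card (u ` (I - {i})) \<le> card (I - {i})" using I by (intro card_image_le) auto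
    also have "\<dots> < DIM('a)" using I i by (simp add: card_Diff_singleton card_gt_0_iff)
    finally have "dim (u ` (I - {i})) < DIM('a)" using I dim_le_card'[of "u ` (I - {i})"] by simp
    then obtain x where x: "x \<noteq> 0" "\<And>y. y \<in> span (u ` (I - {i})) \<Longrightarrow> orthogonal x y"
      using orthogonal_to_subspace_exists by blast
    have z: "u j \<bullet> x = 0" if "j \<in> I" "j \<noteq> i" for j
      using x(2)[of "u j"] that by (auto simp: orthogonal_def inner_commute span_base)
    hence "u i \<bullet> x \<noteq> 0" using common_zero[of x] x(1) by metis
    thus ?thesis using x(1) z by (intro exI[of _ "x /\<^sub>R norm x"]) auto
  qed
  then obtain v where v: "\<And>i. i \<in> I \<Longrightarrow> norm (v i) = 1"
    and uv: "\<And>i j. i \<in> I \<Longrightarrow> j \<in> I \<Longrightarrow> u j \<bullet> v i = 0 \<longleftrightarrow> i \<noteq> j"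
    by metis
  have "card I * cos R \<le> norm (\<Sum>i\<in>I. \<delta> i *\<^sub>R v i)" if \<delta>: "\<And>i. i \<in> I \<Longrightarrow> \<bar>\<delta> i\<bar> = 1" for \<delta>
  proof -
    define p where "p = (\<Sum>i\<in>I. \<delta> i *\<^sub>R v i)"
    have up: "u j \<bullet> p = \<delta> j * (u j \<bullet> v j)" if j: "j \<in> I" for j
    proof -
      have "u j \<bullet> p = (\<Sum>i\<in>I. \<delta> i * (u j \<bullet> v i))" by (simp add: p_def inner_sum_right)
      also have "\<dots> = (\<Sum>i\<in>I. if i = j then \<delta> j * (u j \<bullet> v j) else 0)"
        using uv j by (intro sum.cong) auto
      finally show ?thesis using I j by simp
    qed
    have "u j \<bullet> p \<noteq> 0" if "j \<in> I" for j using up[OF that] uv[OF that that] \<delta>[OF that] by auto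
    then obtain c where c: "norm c = 1"
      "\<And>x. (\<forall>i\<in>I. 0 \<le> (u i \<bullet> x) * (u i \<bullet> p)) \<Longrightarrow> cos R * norm x \<le> c \<bullet> x" using cap by blast
    have vertex: "cos R \<le> c \<bullet> (\<delta> i *\<^sub>R v i)" if i: "i \<in> I" for i
    proof -
      have "0 \<le> (u j \<bullet> (\<delta> i *\<^sub>R v i)) * (u j \<bullet> p)" if j: "j \<in> I" for j
        using uv[OF i j] up[OF j] by (cases "i = j") auto
      hence "cos R * norm (\<delta> i *\<^sub>R v i) \<le> c \<bullet> (\<delta> i *\<^sub>R v i)" using c(2) by blast
      thus ?thesis using v[OF i] \<delta>[OF i] by simp
    qed
    have "card I * cos R = (\<Sum>i\<in>I. cos R)" by simp
    also have "\<dots> \<le> (\<Sum>i\<in>I. c \<bullet> (\<delta> i *\<^sub>R v i))" by (intro sum_mono vertex)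
    also have "\<dots> = c \<bullet> p" by (simp add: p_def inner_sum_right)
    also have "\<dots> \<le> norm p" using norm_cauchy_schwarz[of c p] c(1) by simp
    finally show ?thesis by (simp add: p_def)
  qed
  thus thesis using that v uv by blast
qed

text \<open>Some choice of signs makes the squared norm of the sum of the vertices at most the dimension, while
  every choice makes it at least the squared dimension times \<open>(cos R)\<^sup>2\<close>.\<close>

lemma cos_cap_radius_simplices_le:
  fixes u :: "'i \<Rightarrow> 'a::euclidean_space"
  assumes I: "finite I" "card I = DIM('a)" "I \<noteq> {}" and u: "\<And>i. i \<in> I \<Longrightarrow> u i \<noteq> 0"
    and cov: "cells_covered ((\<lambda>i. equator (u i)) ` I) R" and R: "0 < cos R"
  shows "DIM('a) * (cos R)\<^sup>2 \<le> 1"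
proof -
  obtain v where v: "\<And>i. i \<in> I \<Longrightarrow> norm (v i) = 1"
    and "\<And>i j. i \<in> I \<Longrightarrow> j \<in> I \<Longrightarrow> u j \<bullet> v i = 0 \<longleftrightarrow> i \<noteq> j"
    and le: "\<And>\<delta>. (\<And>i. i \<in> I \<Longrightarrow> \<bar>\<delta> i\<bar> = 1) \<Longrightarrow> card I * cos R \<le> norm (\<Sum>i\<in>I. \<delta> i *\<^sub>R v i)"
    using simplex_vertices[OF I u cov R] by blast
  obtain \<delta> :: "'i \<Rightarrow> real" where \<delta>: "\<And>i. \<bar>\<delta> i\<bar> = 1" "(norm (\<Sum>i\<in>I. \<delta> i *\<^sub>R v i))\<^sup>2 \<le> card I"
    using exists_signs_norm_sum_le[of I v 0] I v by auto
  have "(card I * cos R)\<^sup>2 \<le> (norm (\<Sum>i\<in>I. \<delta> i *\<^sub>R v i))\<^sup>2"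
    using le[of \<delta>, OF \<delta>(1)] R by (intro power_mono) simp_all
  hence "(card I * cos R)\<^sup>2 \<le> card I" using \<delta>(2) by linarith
  hence "card I * (card I * (cos R)\<^sup>2) \<le> card I * 1" by (simp add: power2_eq_square mult_ac)
  moreover have "0 < card I" using I by (simp add: card_gt_0_iff)
  ultimately show ?thesis using I by simp
qed

text \<open>In the case of equality no choice of signs gives a smaller sum, so the vertices \<open>v i\<close> are pairwise
  orthogonal.  The normal \<open>u i\<close> is orthogonal to all other vertices and hence parallel to \<open>v i\<close>.\<close>

lemma orthogonal_normals_if_extremal:
  fixes u :: "'i \<Rightarrow> 'a::euclidean_space"
  assumes I: "finite I" "card I = DIM('a)" "I \<noteq> {}" and u: "\<And>i. i \<in> I \<Longrightarrow> u i \<noteq> 0"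
    and cov: "cells_covered ((\<lambda>i. equator (u i)) ` I) R" and R: "0 < cos R"
    and ext: "DIM('a) * (cos R)\<^sup>2 = 1" and ij: "i \<in> I" "j \<in> I" "i \<noteq> j"
  shows "u i \<bullet> u j = 0"
proof -
  obtain v where v: "\<And>i. i \<in> I \<Longrightarrow> norm (v i) = 1"
    and uv: "\<And>i j. i \<in> I \<Longrightarrow> j \<in> I \<Longrightarrow> u j \<bullet> v i = 0 \<longleftrightarrow> i \<noteq> j"
    and le: "\<And>\<delta>. (\<And>i. i \<in> I \<Longrightarrow> \<bar>\<delta> i\<bar> = 1) \<Longrightarrow> card I * cos R \<le> norm (\<Sum>i\<in>I. \<delta> i *\<^sub>R v i)"
    using simplex_vertices[OF I u cov R] by blast
  have vv: "v a \<bullet> v b = 0" if ab: "a \<in> I" "b \<in> I" "a \<noteq> b" for a b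
  proof (rule ccontr)
    assume "v a \<bullet> v b \<noteq> 0"
    then obtain \<delta> :: "'i \<Rightarrow> real" where \<delta>: "\<And>i. \<bar>\<delta> i\<bar> = 1" "(norm (\<Sum>i\<in>I. \<delta> i *\<^sub>R v i))\<^sup>2 < card I"
      using exists_signs_norm_sum_less[of I v a b, OF I(1) v ab] by blast
    have "(card I * cos R)\<^sup>2 \<le> (norm (\<Sum>i\<in>I. \<delta> i *\<^sub>R v i))\<^sup>2"
      using le[of \<delta>, OF \<delta>(1)] R by (intro power_mono) simp_all
    hence "(card I * cos R)\<^sup>2 < card I" using \<delta>(2) by linarith
    moreover have "(card I * cos R)\<^sup>2 = card I * (DIM('a) * (cos R)\<^sup>2)"
      using I by (simp add: power2_eq_square mult_ac)
    ultimately show False using ext by simp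
  qed
  have "(\<Sum>k\<in>I. (v k \<bullet> u i) *\<^sub>R v k) = (\<Sum>k\<in>I. if k = i then (v i \<bullet> u i) *\<^sub>R v i else 0)"
    using uv ij(1) by (intro sum.cong) (auto simp: inner_commute)
  hence "u i = (v i \<bullet> u i) *\<^sub>R v i"
    using orthonormal_expansion[of I v "u i", OF I(1,2) v vv] I ij by simp
  moreover have "v i \<bullet> u j = 0" using uv[of i j] ij by (simp add: inner_commute)
  ultimately show ?thesis by (metis inner_scaleR_left mult_zero_right)
qed

text \<open>The centre of the cap is the barycentre of an orthant.  For \<open>x\<close> in the orthant, its inner product with
  the unnormalised centre is the sum of the absolute coordinates of \<open>x\<close>, which is at least
  \<open>norm x\<close>.\<close>

lemma cells_covered_if_orthogonal_normals:
  fixes u :: "'i \<Rightarrow> 'a::euclidean_space"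
  assumes I: "finite I" "card I = DIM('a)" "I \<noteq> {}" and u: "\<And>i. i \<in> I \<Longrightarrow> norm (u i) = 1"
    and orth: "\<And>i j. i \<in> I \<Longrightarrow> j \<in> I \<Longrightarrow> i \<noteq> j \<Longrightarrow> u i \<bullet> u j = 0"
  shows "cells_covered ((\<lambda>i. equator (u i)) ` I) (arccos (1 / sqrt (DIM('a))))"
  unfolding cells_covered_iff[OF I(3)]
proof (intro allI impI)
  fix p assume p: "norm p = 1 \<and> (\<forall>i\<in>I. u i \<bullet> p \<noteq> 0)"
  define s where "s = (\<Sum>i\<in>I. sgn (u i \<bullet> p) *\<^sub>R u i)"
  have su: "u k \<bullet> s = sgn (u k \<bullet> p)" if k: "k \<in> I" for k
  proof -
    have "u k \<bullet> s = (\<Sum>i\<in>I. if i = k then sgn (u k \<bullet> p) else 0)"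
      unfolding s_def inner_sum_right
      by (intro sum.cong) (use u k orth in \<open>auto simp: dot_square_norm\<close>)
    thus ?thesis using I k by simp
  qed
  have "s \<bullet> s = (\<Sum>i\<in>I. sgn (u i \<bullet> p) * (u i \<bullet> s))"
    by (subst (1) s_def) (simp add: inner_sum_left)
  also have "\<dots> = (\<Sum>i\<in>I. 1)"
    by (intro sum.cong) (use su p in \<open>auto simp: sgn_if\<close>)
  finally have ns: "norm s = sqrt (DIM('a))" using I by (simp add: norm_eq_sqrt_inner)
  let ?c = "s /\<^sub>R sqrt (DIM('a))"
  have "1 / sqrt (DIM('a)) \<le> ?c \<bullet> x" if x: "x \<in> chamber u I p" for x
  proof -
    have nx: "norm x = 1" using x by (simp add: chamber_def)
    have "1 \<le> norm (\<Sum>i\<in>I. (u i \<bullet> x) *\<^sub>R u i)"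
      using orthonormal_expansion[of I u x, OF I(1,2) u orth] nx by simp
    also have "\<dots> \<le> (\<Sum>i\<in>I. \<bar>u i \<bullet> x\<bar>)"
      by (rule sum_norm_le) (simp add: u)
    also have "\<dots> = (\<Sum>i\<in>I. sgn (u i \<bullet> p) * (u i \<bullet> x))"
      by (intro sum.cong) (use x in \<open>auto simp: chamber_def sgn_if zero_less_mult_iff\<close>)
    also have "\<dots> = s \<bullet> x" by (simp add: s_def inner_sum_left)
    finally have "1 / sqrt (DIM('a)) \<le> (s \<bullet> x) / sqrt (DIM('a))" by (intro divide_right_mono) auto
    thus ?thesis by (simp add: divide_inverse mult.commute)
  qed
  moreover have "norm ?c = 1" using ns by simp
  moreover have "cos (arccos (1 / sqrt (DIM('a)))) = 1 / sqrt (DIM('a))"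
  proof (rule cos_arccos)
    show "- 1 \<le> 1 / sqrt (real DIM('a))" by (rule order.trans[of _ 0]) auto
    show "1 / sqrt (real DIM('a)) \<le> 1" using DIM_positive[where 'a='a] by (simp add: Suc_leI)
  qed
  ultimately show "\<exists>c. norm c = 1 \<and> (\<forall>x\<in>chamber u I p. cos (arccos (1 / sqrt (DIM('a)))) \<le> c \<bullet> x)"
    by (intro exI[of _ ?c]) simp
qed

section \<open>A lower bound from a great circle\<close>

lemma norm_cos_sin:
  fixes p b :: "'a::euclidean_space"
  assumes "norm p = 1" "norm b = 1" "p \<bullet> b = 0"
  shows "norm (cos \<theta> *\<^sub>R p + sin \<theta> *\<^sub>R b) = 1"
proof -
  have "p \<bullet> p = 1" "b \<bullet> b = 1" using assms by (simp_all add: dot_square_norm)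
  hence "(cos \<theta> *\<^sub>R p + sin \<theta> *\<^sub>R b) \<bullet> (cos \<theta> *\<^sub>R p + sin \<theta> *\<^sub>R b) = (cos \<theta>)\<^sup>2 + (sin \<theta>)\<^sup>2"
    using assms by (simp add: inner_add_left inner_add_right inner_commute power2_eq_square)
  thus ?thesis by (simp add: norm_eq_1)
qed

text \<open>An arc of half-length \<open>h\<close> on a great circle does not fit into a cap of radius less than \<open>h\<close>.  For two
  points at angular distance \<open>s\<close> from the midpoint \<open>m\<close> of the arc, the sum is \<open>(2 * cos s) *\<^sub>R m\<close>,
  so one of them has inner product at most \<open>cos s\<close> with the centre of the cap.\<close>

lemma half_angle_le_cap_radius:
  fixes c p b :: "'a::euclidean_space"
  assumes c: "norm c = 1" and p: "norm p = 1" and R: "0 \<le> R" "R \<le> pi"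
    and h: "0 < h" "h \<le> pi / 2"
    and cap: "\<And>\<theta>. t - h < \<theta> \<Longrightarrow> \<theta> < t + h \<Longrightarrow> cos R \<le> c \<bullet> (cos \<theta> *\<^sub>R p + sin \<theta> *\<^sub>R b)"
    and b: "norm b = 1" and pb: "p \<bullet> b = 0"
  shows "h \<le> R"
proof (rule dense_le)
  fix s assume s: "s < h"
  show "s \<le> R"
  proof (cases "0 < s")
    case True
    define g where "g \<theta> = cos \<theta> *\<^sub>R p + sin \<theta> *\<^sub>R b" for \<theta>
    have gt: "norm (g t) = 1" unfolding g_def by (rule norm_cos_sin[OF p b pb])
    have "cos R \<le> c \<bullet> g (t - s)" "cos R \<le> c \<bullet> g (t + s)"
      unfolding g_def by (rule cap; use True s in simp)+
    moreover have "g (t - s) + g (t + s) = (2 * cos s) *\<^sub>R g t"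
      by (simp add: g_def cos_add cos_diff sin_add sin_diff algebra_simps flip: scaleR_2)
    hence "c \<bullet> g (t - s) + c \<bullet> g (t + s) = 2 * cos s * (c \<bullet> g t)"
      by (metis inner_add_right inner_scaleR_right)
    moreover have "c \<bullet> g t \<le> 1" using norm_cauchy_schwarz[of c "g t"] c gt by simp
    moreover have "0 \<le> cos s" using True s h by (intro cos_ge_zero) auto
    ultimately have "cos R \<le> cos s"
      using mult_left_mono[of "c \<bullet> g t" 1 "cos s"] by simp
    thus ?thesis using True s h R by (subst (asm) cos_mono_le_eq) auto
  qed (use R in simp)
qed

text \<open>A great circle through a generic point \<open>p\<close> meets each of the \<open>n\<close> great spheres at most once within an open
  half circle.  Cutting this half circle into \<open>n + 1\<close> equal arcs leaves, by the pigeonhole principle,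
  an arc without intersection points.  It lies in one cell, whose cap must contain it.\<close>

lemma cap_radius_lower_bound:
  fixes \<A> :: "'a::euclidean_space set set"
  assumes d: "2 \<le> DIM('a)" and n: "0 < n" and A: "gs_arrangement n \<A>"
    and cov: "cells_covered \<A> R" and R: "0 \<le> R" "R \<le> pi / 2"
  shows "pi / (2 * (real n + 1)) \<le> R"
proof -
  obtain u where u: "\<And>G. G \<in> \<A> \<Longrightarrow> norm (u G) = 1" "\<And>G. G \<in> \<A> \<Longrightarrow> equator (u G) = G"
    using gs_arrangement_normals[OF d A] by metis
  have fin: "finite \<A>" and card: "card \<A> = n" using A by (auto simp: gs_arrangement_def)
  have ne: "\<A> \<noteq> {}" using card n by auto
  have u0: "u G \<noteq> 0" if "G \<in> \<A>" for G using u(1)[OF that] by auto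
  obtain p where p: "norm p = 1" "\<And>G. G \<in> \<A> \<Longrightarrow> u G \<bullet> p \<noteq> 0"
    using exists_unit_vector_off_hyperplanes[of \<A> u, OF fin u0] by blast
  obtain b' where b': "b' \<noteq> 0" "orthogonal b' p"
    using orthogonal_to_vector_exists[OF d] by (metis orthogonal_commute)
  define b where "b = b' /\<^sub>R norm b'"
  have b: "norm b = 1" "p \<bullet> b = 0" using b' by (auto simp: b_def orthogonal_def inner_commute)
  define g where "g \<theta> = cos \<theta> *\<^sub>R p + sin \<theta> *\<^sub>R b" for \<theta>
  have ng: "norm (g \<theta>) = 1" for \<theta>
    unfolding g_def by (rule norm_cos_sin[OF p(1) b])
  define \<delta> where "\<delta> = pi / (real n + 1)"
  have \<delta>: "0 < \<delta>" "(real n + 1) * \<delta> = pi" by (auto simp: \<delta>_def)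
  have one_zero: "\<theta> = \<phi>" if G: "G \<in> \<A>" and z: "u G \<bullet> g \<theta> = 0" "u G \<bullet> g \<phi> = 0"
    and r: "0 < \<theta>" "\<theta> < pi" "0 < \<phi>" "\<phi> < pi" for G \<theta> \<phi>
  proof -
    let ?x = "u G \<bullet> p" and ?y = "u G \<bullet> b"
    have 1: "cos \<theta> * ?x + sin \<theta> * ?y = 0" "cos \<phi> * ?x + sin \<phi> * ?y = 0"
      using z by (auto simp: g_def inner_add_right)
    have "sin (\<theta> - \<phi>) * ?x = sin \<theta> * (cos \<phi> * ?x + sin \<phi> * ?y) - sin \<phi> * (cos \<theta> * ?x + sin \<theta> * ?y)"
      by (simp add: sin_diff algebra_simps)
    hence s: "sin (\<theta> - \<phi>) = 0" using 1 p(2)[OF G] by simp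
    show ?thesis
    proof (rule ccontr)
      assume "\<theta> \<noteq> \<phi>"
      then consider "0 < \<theta> - \<phi>" | "0 < \<phi> - \<theta>" by linarith
      thus False
      proof cases
        case 1 thus False using sin_gt_zero[of "\<theta> - \<phi>"] s r by simp
      next
        case 2 thus False using sin_gt_zero[of "\<phi> - \<theta>"] s r sin_minus[of "\<theta> - \<phi>"] by simp
      qed
    qed
  qed
  \<comment> \<open>Zeros in all \<open>n + 1\<close> arcs would belong to different great spheres.\<close>
  have "\<exists>k\<le>n. \<forall>G\<in>\<A>. \<forall>\<theta>. real k * \<delta> < \<theta> \<and> \<theta> < (real k + 1) * \<delta> \<longrightarrow> u G \<bullet> g \<theta> \<noteq> 0"
  proof (rule ccontr)
    assume "\<not> ?thesis"
    hence "\<forall>k\<in>{..n}. \<exists>G \<theta>. G \<in> \<A> \<and> real k * \<delta> < \<theta> \<and> \<theta> < (real k + 1) * \<delta> \<and> u G \<bullet> g \<theta> = 0"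
      by (simp add: Ball_def)
    then obtain G \<theta> where G: "\<And>k. k \<le> n \<Longrightarrow> G k \<in> \<A> \<and> real k * \<delta> < \<theta> k \<and> \<theta> k < (real k + 1) * \<delta> \<and> u (G k) \<bullet> g (\<theta> k) = 0"
      by (metis atMost_iff)
    have range: "0 < \<theta> k" "\<theta> k < pi" if "k \<le> n" for k
    proof -
      show "0 < \<theta> k" using G[OF that] \<delta>(1) by (smt (verit) mult_nonneg_nonneg of_nat_0_le_iff)
      have "(real k + 1) * \<delta> \<le> (real n + 1) * \<delta>" using that \<delta>(1) by simp
      thus "\<theta> k < pi" using G[OF that] \<delta>(2) by linarith
    qed
    have "inj_on G {..n}"
    proof (rule inj_onI)
      fix k l assume kl: "k \<in> {..n}" "l \<in> {..n}" "G k = G l"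
      hence kn: "k \<le> n" "l \<le> n" by auto
      have eq: "\<theta> k = \<theta> l"
        by (rule one_zero[of "G k"]) (use G[OF kn(1)] G[OF kn(2)] kl(3) range[OF kn(1)] range[OF kn(2)] in auto)
      have "real k * \<delta> < (real l + 1) * \<delta>" "real l * \<delta> < (real k + 1) * \<delta>"
        using G[of k] G[of l] kl eq by auto
      hence "real k < real l + 1" "real l < real k + 1" using \<delta>(1) by (auto simp: mult_less_cancel_right)
      thus "k = l" by linarith
    qed
    moreover have "G ` {..n} \<subseteq> \<A>" using G by auto
    ultimately have "card {..n} \<le> card \<A>" using fin by (metis card_inj_on_le)
    thus False using card by simp
  qed
  then obtain k where k: "k \<le> n" "\<And>G \<theta>. G \<in> \<A> \<Longrightarrow> real k * \<delta> < \<theta> \<Longrightarrow> \<theta> < (real k + 1) * \<delta> \<Longrightarrow> u G \<bullet> g \<theta> \<noteq> 0"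
    by blast
  let ?J = "{real k * \<delta> <..< (real k + 1) * \<delta>}"
  define t where "t = (real k + 1/2) * \<delta>"
  have J: "?J = {t - \<delta>/2 <..< t + \<delta>/2}" by (simp add: t_def algebra_simps)
  have con: "connected (g ` ?J)"
    unfolding g_def by (rule connected_continuous_image) (auto intro!: continuous_intros)
  have tJ: "t \<in> ?J" unfolding J using \<delta>(1) by simp
  have sub: "g ` ?J \<subseteq> chamber u \<A> (g t)"
    by (rule connected_subset_chamber[OF con]) (use tJ ng k in auto)
  have nz: "\<And>G. G \<in> \<A> \<Longrightarrow> u G \<bullet> g t \<noteq> 0" using tJ k(2) by auto
  have cov': "cells_covered ((\<lambda>G. equator (u G)) ` \<A>) R" using cov u(2) by simp
  obtain c where c: "norm c = 1" "\<And>x. x \<in> chamber u \<A> (g t) \<Longrightarrow> cos R \<le> c \<bullet> x"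
    using cov' ng nz unfolding cells_covered_iff[OF ne] by meson
  have "pi / (2 * (real n + 1)) = \<delta> / 2" by (simp add: \<delta>_def)
  moreover have "\<delta> \<le> pi"
    using mult_right_mono[of 1 "real n + 1" \<delta>] \<delta> by simp
  moreover have "\<delta> / 2 \<le> R"
  proof (rule half_angle_le_cap_radius[OF c(1) p(1), where t = t and b = b])
    fix \<theta> assume "t - \<delta> / 2 < \<theta>" "\<theta> < t + \<delta> / 2"
    hence "g \<theta> \<in> g ` ?J" unfolding J by auto
    thus "cos R \<le> c \<bullet> (cos \<theta> *\<^sub>R p + sin \<theta> *\<^sub>R b)" using c(2) sub unfolding g_def[symmetric] by blast
  qed (use R \<delta>(1) b \<open>\<delta> \<le> pi\<close> in auto)
  ultimately show ?thesis by (simp only:)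
qed

section \<open>The minimal radius is attained\<close>

lemma cells_covered_superset:
  assumes AB: "\<A> \<subseteq> \<B>" and cov: "cells_covered \<A> R"
  shows "cells_covered \<B> R"
  unfolding cells_covered_def
proof
  fix C assume "C \<in> cells \<B>"
  then obtain p where p: "p \<in> sphere 0 1 - \<Union>\<B>"
    and C: "C = closure (connected_component_set (sphere 0 1 - \<Union>\<B>) p)"
    by (auto simp: cells_def components_def)
  let ?C = "closure (connected_component_set (sphere 0 1 - \<Union>\<A>) p)"
  have "p \<in> sphere 0 1 - \<Union>\<A>" using p AB by blast
  hence "?C \<in> cells \<A>" by (auto simp: cells_def components_def)
  moreover have "C \<subseteq> ?C"
    unfolding C by (intro closure_mono connected_component_mono) (use AB in blast)
  ultimately show "\<exists>x\<in>sphere 0 1. C \<subseteq> spherical_cap x R"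
    using cov unfolding cells_covered_def by blast
qed

lemma gs_arrangement_extend:
  fixes \<A> :: "'a::euclidean_space set set"
  assumes d: "2 \<le> DIM('a)" and A: "finite \<A>" "card \<A> \<le> n" "\<And>G. G \<in> \<A> \<Longrightarrow> great_sphere (DIM('a) - 2) G"
  obtains \<B> where "\<A> \<subseteq> \<B>" "gs_arrangement n \<B>"
proof -
  have "infinite (equator ` {u :: 'a. u \<noteq> 0} - \<A>)"
    using infinite_equators[OF d] A(1) by (rule Diff_infinite_finite[rotated])
  then obtain \<C> where C: "finite \<C>" "card \<C> = n - card \<A>" "\<C> \<subseteq> equator ` {u :: 'a. u \<noteq> 0} - \<A>"
    using infinite_arbitrarily_large by blast
  have "card (\<A> \<union> \<C>) = n" using C A by (subst card_Un_disjoint) auto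
  moreover have "great_sphere (DIM('a) - 2) G" if "G \<in> \<A> \<union> \<C>" for G
    using that A(3) C(3) great_sphere_equator[OF d] by blast
  ultimately have "gs_arrangement n (\<A> \<union> \<C>)" using A C by (simp add: gs_arrangement_def)
  thus thesis using that by blast
qed

lemma gs_arrangement_indexed_normals:
  fixes \<A> :: "'a::euclidean_space set set"
  assumes d: "2 \<le> DIM('a)" and A: "gs_arrangement n \<A>"
  obtains u where "\<And>i. i < n \<Longrightarrow> norm (u i) = 1" "(\<lambda>i. equator (u i)) ` {..<n} = \<A>"
proof -
  obtain w where w: "\<And>G. G \<in> \<A> \<Longrightarrow> norm (w G) = 1" "\<And>G. G \<in> \<A> \<Longrightarrow> equator (w G) = G"
    using gs_arrangement_normals[OF d A] by metis
  obtain h where "bij_betw h {0..<n} \<A>"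
    using A ex_bij_betw_nat_finite[of \<A>] by (auto simp: gs_arrangement_def)
  hence h: "h ` {..<n} = \<A>" by (simp add: bij_betw_def atLeast0LessThan)
  have "(\<lambda>i. equator (w (h i))) ` {..<n} = (\<lambda>G. equator (w G)) ` \<A>" by (simp add: h[symmetric] image_image)
  also have "\<dots> = \<A>" using w(2) by simp
  finally show thesis using that[of "\<lambda>i. w (h i)"] w(1) h by blast
qed

lemma unit_families_convergent_subseq:
  fixes f :: "nat \<Rightarrow> 'i \<Rightarrow> 'a::euclidean_space"
  assumes I: "finite I" and f: "\<And>k i. i \<in> I \<Longrightarrow> norm (f k i) = 1"
  obtains r l where "strict_mono r" "\<And>i. i \<in> I \<Longrightarrow> (\<lambda>k. f (r k) i) \<longlonglongrightarrow> l i"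
proof -
  have "\<forall>d\<subseteq>I. \<exists>l. \<exists>r. strict_mono r \<and>
      (\<forall>e>0. eventually (\<lambda>n. \<forall>i\<in>d. dist (f (r n) i) (l i) < e) sequentially)"
    by (rule compact_lemma_general[where proj = "\<lambda>x i. x i" and unproj = "\<lambda>x. x", OF I])
      (auto simp: bounded_iff f intro!: exI[of _ 1])
  then obtain l r where r: "strict_mono r"
    and ev: "\<And>e. e > 0 \<Longrightarrow> eventually (\<lambda>n. \<forall>i\<in>I. dist (f (r n) i) (l i) < e) sequentially"
    by blast
  have "(\<lambda>k. f (r k) i) \<longlonglongrightarrow> l i" if "i \<in> I" for i
    unfolding tendsto_iff using that by (auto intro: eventually_mono[OF ev])
  thus thesis using that r by blast
qed

text \<open>Since chambers are given by strict inequalities, a point of a chamber of the limit lies eventually in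
  the corresponding chambers of the sequence.  So it is enough to take an accumulation point of the
  centres of the covering caps.  The limits of different normals may be parallel.\<close>

lemma cells_covered_limit:
  fixes u :: "nat \<Rightarrow> 'i \<Rightarrow> 'a::euclidean_space"
  assumes I: "finite I" "I \<noteq> {}"
    and cov: "\<And>k. cells_covered ((\<lambda>i. equator (u k i)) ` I) (R k)"
    and ul: "\<And>i. i \<in> I \<Longrightarrow> (\<lambda>k. u k i) \<longlonglongrightarrow> l i" and Rr: "R \<longlonglongrightarrow> r"
  shows "cells_covered ((\<lambda>i. equator (l i)) ` I) r"
  unfolding cells_covered_iff[OF I(2)]
proof (intro allI impI)
  fix p assume p: "norm p = 1 \<and> (\<forall>i\<in>I. l i \<bullet> p \<noteq> 0)"
  have ev_chamber: "eventually (\<lambda>k. x \<in> chamber (u k) I p) sequentially" if x: "x \<in> chamber l I p" for x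
  proof -
    have "eventually (\<lambda>k. \<forall>i\<in>I. 0 < (u k i \<bullet> x) * (u k i \<bullet> p)) sequentially"
    proof (rule eventually_ball_finite[OF I(1)], rule ballI)
      fix i assume i: "i \<in> I"
      have "(\<lambda>k. (u k i \<bullet> x) * (u k i \<bullet> p)) \<longlonglongrightarrow> (l i \<bullet> x) * (l i \<bullet> p)"
        by (intro tendsto_intros ul[OF i])
      moreover have "0 < (l i \<bullet> x) * (l i \<bullet> p)" using x i by (simp add: chamber_def)
      ultimately show "eventually (\<lambda>k. 0 < (u k i \<bullet> x) * (u k i \<bullet> p)) sequentially"
        by (rule order_tendstoD(1))
    qed
    thus ?thesis using x by (simp add: chamber_def)
  qed
  have "\<exists>c. norm c = 1 \<and> ((\<forall>i\<in>I. u k i \<bullet> p \<noteq> 0) \<longrightarrow> (\<forall>x\<in>chamber (u k) I p. cos (R k) \<le> c \<bullet> x))" for k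
    using cov[of k] p unfolding cells_covered_iff[OF I(2)] by blast
  then obtain c where c: "\<And>k. norm (c k) = 1"
    "\<And>k x. \<forall>i\<in>I. u k i \<bullet> p \<noteq> 0 \<Longrightarrow> x \<in> chamber (u k) I p \<Longrightarrow> cos (R k) \<le> c k \<bullet> x"
    by metis
  have "\<forall>k. c k \<in> sphere 0 1" using c(1) by simp
  then obtain a \<rho> where a: "a \<in> sphere 0 1" and \<rho>: "strict_mono \<rho>" and ca: "(c \<circ> \<rho>) \<longlonglongrightarrow> a"
    using compact_sphere[of "0::'a" 1] unfolding compact_def by meson
  have "cos r \<le> a \<bullet> x" if x: "x \<in> chamber l I p" for x
  proof (rule tendsto_le[OF sequentially_bot])
    show "(\<lambda>k. cos (R (\<rho> k))) \<longlonglongrightarrow> cos r"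
      by (intro tendsto_cos LIMSEQ_subseq_LIMSEQ[OF Rr \<rho>, unfolded o_def])
    show "(\<lambda>k. c (\<rho> k) \<bullet> x) \<longlonglongrightarrow> a \<bullet> x"
      using ca unfolding o_def by (intro tendsto_intros)
    have "eventually (\<lambda>k. cos (R k) \<le> c k \<bullet> x) sequentially"
      using ev_chamber[OF x]
    proof eventually_elim
      case (elim k)
      have "\<forall>i\<in>I. u k i \<bullet> p \<noteq> 0" using elim by (auto simp: chamber_def)
      thus ?case using c(2) elim by blast
    qed
    thus "eventually (\<lambda>k. cos (R (\<rho> k)) \<le> c (\<rho> k) \<bullet> x) sequentially"
      by (rule eventually_subseq[OF \<rho>])
  qed
  thus "\<exists>c. norm c = 1 \<and> (\<forall>x\<in>chamber l I p. cos r \<le> c \<bullet> x)" using a by auto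
qed

definition covering_radii :: "'a::euclidean_space itself \<Rightarrow> nat \<Rightarrow> real set" where
  "covering_radii E n = {R. 0 < R \<and> R \<le> pi / 2 \<and>
     (\<exists>\<A> :: 'a set set. gs_arrangement n \<A> \<and> cells_covered \<A> R)}"

text \<open>A family that defines fewer than \<open>n\<close> great spheres can be enlarged to exactly \<open>n\<close> of them, because
  further great spheres only subdivide the cells.\<close>

lemma covering_radiiI:
  fixes u :: "'i \<Rightarrow> 'a::euclidean_space"
  assumes d: "2 \<le> DIM('a)" and I: "finite I" "card I \<le> n" "\<And>i. i \<in> I \<Longrightarrow> u i \<noteq> 0"
    and R: "0 < R" "R \<le> pi / 2" and cov: "cells_covered ((\<lambda>i. equator (u i)) ` I) R"
  shows "R \<in> covering_radii TYPE('a) n"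
proof -
  have "card ((\<lambda>i. equator (u i)) ` I) \<le> n" using card_image_le[OF I(1)] I(2) by (rule order.trans)
  then obtain \<B> where "(\<lambda>i. equator (u i)) ` I \<subseteq> \<B>" "gs_arrangement n \<B>"
    using gs_arrangement_extend[OF d, of "(\<lambda>i. equator (u i)) ` I" n] great_sphere_equator[OF d] I
    by (metis (no_types, lifting) finite_imageI imageE)
  thus ?thesis using cells_covered_superset[OF _ cov] R by (auto simp: covering_radii_def)
qed

lemma right_angle_mem_covering_radii:
  assumes d: "2 \<le> DIM('a::euclidean_space)" and n: "0 < n"
  shows "pi / 2 \<in> covering_radii TYPE('a) n"
proof -
  obtain u :: 'a where u: "norm u = 1" using vector_choose_size[of 1] by auto
  have "cells_covered ((\<lambda>i. equator u) ` {()}) (pi / 2)"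
    unfolding cells_covered_iff[of "{()}" "\<lambda>_. u", OF insert_not_empty]
  proof (intro allI impI)
    fix p assume "norm p = 1 \<and> (\<forall>i\<in>{()}. u \<bullet> p \<noteq> 0)"
    hence "norm (sgn (u \<bullet> p) *\<^sub>R u) = 1" using u by (simp add: sgn_if)
    moreover have "cos (pi / 2) \<le> (sgn (u \<bullet> p) *\<^sub>R u) \<bullet> x" if "x \<in> chamber (\<lambda>_. u) {()} p" for x
      using that by (auto simp: chamber_def sgn_if zero_less_mult_iff)
    ultimately show "\<exists>c. norm c = 1 \<and> (\<forall>x\<in>chamber (\<lambda>_. u) {()} p. cos (pi / 2) \<le> c \<bullet> x)" by blast
  qed
  thus ?thesis using u n by (intro covering_radiiI[OF d, where I = "{()}" and u = "\<lambda>_. u"]) auto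
qed

text \<open>Compactness of the space of unit normals: an arrangement that is a limit for radii tending to the
  infimum realises the infimum.  Great spheres that coincide in the limit are replaced by arbitrary
  new ones, and \<open>cap_radius_lower_bound\<close> keeps the infimum positive.\<close>

lemma least_covering_radius:
  assumes d: "2 \<le> DIM('a::euclidean_space)" and n: "0 < n"
  shows "R_gs TYPE('a) n \<in> covering_radii TYPE('a) n"
    and "\<And>R. R \<in> covering_radii TYPE('a) n \<Longrightarrow> R_gs TYPE('a) n \<le> R"
proof -
  let ?S = "covering_radii TYPE('a) n"
  define r where "r = Inf ?S"
  have S_ge: "pi / (2 * (real n + 1)) \<le> R" if "R \<in> ?S" for R
    using that cap_radius_lower_bound[OF d n] by (auto simp: covering_radii_def)
  have ne: "?S \<noteq> {}" using right_angle_mem_covering_radii[OF d n] by blast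
  have bdd: "bdd_below ?S" using S_ge by (rule bdd_belowI)
  have r_le: "r \<le> R" if "R \<in> ?S" for R unfolding r_def using that bdd by (rule cInf_lower)
  have "0 < pi / (2 * (real n + 1))" by simp
  also have "\<dots> \<le> r" unfolding r_def using ne S_ge by (rule cInf_greatest)
  finally have r0: "0 < r" .
  have r1: "r \<le> pi / 2" using r_le right_angle_mem_covering_radii[OF d n] by blast
  have "\<exists>R. R \<in> ?S \<and> R < r + 1 / real (Suc k)" for k
    using cInf_lessD[OF ne, of "r + 1 / real (Suc k)"] unfolding r_def by auto
  then obtain R where R: "\<And>k. R k \<in> ?S" "\<And>k. R k < r + 1 / real (Suc k)" by metis
  have "\<exists>u :: nat \<Rightarrow> 'a. (\<forall>i<n. norm (u i) = 1) \<and> cells_covered ((\<lambda>i. equator (u i)) ` {..<n}) (R k)" for k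
  proof -
    obtain \<A> :: "'a set set" where "gs_arrangement n \<A>" "cells_covered \<A> (R k)"
      using R(1)[of k] by (auto simp: covering_radii_def)
    thus ?thesis using gs_arrangement_indexed_normals[OF d] by metis
  qed
  then obtain u :: "nat \<Rightarrow> nat \<Rightarrow> 'a" where u: "\<And>k i. i < n \<Longrightarrow> norm (u k i) = 1"
    and cov: "\<And>k. cells_covered ((\<lambda>i. equator (u k i)) ` {..<n}) (R k)"
    by metis
  obtain \<rho> l where \<rho>: "strict_mono \<rho>" and l: "\<And>i. i \<in> {..<n} \<Longrightarrow> (\<lambda>k. u (\<rho> k) i) \<longlonglongrightarrow> l i"
    using unit_families_convergent_subseq[of "{..<n}" u] u by auto
  have "R \<longlonglongrightarrow> r"
  proof (rule tendsto_sandwich[OF _ _ tendsto_const])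
    show "eventually (\<lambda>k. r \<le> R k) sequentially" using r_le R(1) by simp
    show "eventually (\<lambda>k. R k \<le> r + 1 / real (Suc k)) sequentially"
      using R(2) by (intro always_eventually allI less_imp_le)
    show "(\<lambda>k. r + 1 / real (Suc k)) \<longlonglongrightarrow> r"
      using tendsto_add[OF tendsto_const LIMSEQ_Suc[OF lim_1_over_n], of r] by simp
  qed
  from LIMSEQ_subseq_LIMSEQ[OF this \<rho>]
  have R\<rho>: "(\<lambda>k. R (\<rho> k)) \<longlonglongrightarrow> r" by (simp add: o_def)
  have cl: "cells_covered ((\<lambda>i. equator (l i)) ` {..<n}) r"
    by (rule cells_covered_limit[OF _ _ cov l R\<rho>]) (use n in \<open>simp_all add: lessThan_empty_iff\<close>)
  have "norm (l i) = 1" if i: "i < n" for i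
  proof -
    have "(\<lambda>k. norm (u (\<rho> k) i)) \<longlonglongrightarrow> norm (l i)" using i by (intro tendsto_norm l) simp
    thus ?thesis using i by (simp add: u LIMSEQ_const_iff)
  qed
  hence l0: "\<And>i. i \<in> {..<n} \<Longrightarrow> l i \<noteq> 0" by (metis lessThan_iff norm_zero zero_neq_one)
  have rS: "r \<in> ?S"
    by (rule covering_radiiI[OF d _ _ l0 r0 r1 cl]) simp_all
  have "R_gs TYPE('a) n = (LEAST R. R \<in> ?S)" by (simp add: R_gs_def covering_radii_def)
  also have "\<dots> = r" using rS r_le by (rule Least_equality)
  finally have eq: "R_gs TYPE('a) n = r" .
  show "R_gs TYPE('a) n \<in> ?S" using rS eq by simp
  show "\<And>R. R \<in> ?S \<Longrightarrow> R_gs TYPE('a) n \<le> R" using r_le eq by simp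
qed

section \<open>Central projection of cubical grids\<close>

text \<open>If \<open>P\<close> and \<open>Q\<close> lie outside the open unit ball, the sine of the angle between them is at most their
  distance; \<open>e\<close> bounds the square of the distance.  The first inequality says this with the cosine,
  the second one makes the angle acute.\<close>

lemma inner_squared_ge_if_close:
  fixes P Q :: "'a::real_inner"
  assumes P: "1 \<le> P \<bullet> P" and Q: "1 \<le> Q \<bullet> Q" and PQ: "(Q - P) \<bullet> (Q - P) \<le> e"
  shows "(1 - e) * ((P \<bullet> P) * (Q \<bullet> Q)) \<le> (P \<bullet> Q)\<^sup>2" and "2 - e \<le> 2 * (P \<bullet> Q)"
proof -
  define A B C where "A = P \<bullet> P" and "B = P \<bullet> (Q - P)" and "C = (Q - P) \<bullet> (Q - P)"
  have e: "P \<bullet> Q = A + B" "Q \<bullet> Q = A + 2 * B + C"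
    by (simp_all add: A_def B_def C_def inner_diff_left inner_diff_right inner_commute)
  have C: "0 \<le> C" "C \<le> e" using PQ by (auto simp: C_def)
  have "A * C \<le> A * (e * (Q \<bullet> Q))"
    using P Q C mult_mono[of C e 1 "Q \<bullet> Q"] by (intro mult_left_mono) (auto simp: A_def)
  moreover have "(A + B)\<^sup>2 = A * (Q \<bullet> Q) + B\<^sup>2 - A * C"
    unfolding e by (simp add: power2_eq_square algebra_simps)
  moreover have "0 \<le> B\<^sup>2" by simp
  ultimately have "A * (Q \<bullet> Q) - A * (e * (Q \<bullet> Q)) \<le> (P \<bullet> Q)\<^sup>2" unfolding e(1) by linarith
  thus "(1 - e) * ((P \<bullet> P) * (Q \<bullet> Q)) \<le> (P \<bullet> Q)\<^sup>2" by (simp add: A_def algebra_simps)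
  have "2 * (P \<bullet> Q) = P \<bullet> P + Q \<bullet> Q - C"
    by (simp add: C_def inner_diff_left inner_diff_right inner_commute)
  thus "2 - e \<le> 2 * (P \<bullet> Q)" using P Q C by linarith
qed

text \<open>The hyperplanes with equations \<open>x \<bullet> i = (k / m) * (x \<bullet> j)\<close>.  On each facet of the cube
  with vertices \<open>(\<plusminus> 1, \<dots>, \<plusminus> 1)\<close> they cut out the grid of mesh \<open>1 / m\<close>; those with \<open>k = \<plusminus> m\<close> separate the cones over the
  facets and those with \<open>k = 0\<close> the orthants.\<close>

definition grid_indices :: "nat \<Rightarrow> ('a::euclidean_space \<times> 'a \<times> int) set" where
  "grid_indices m = {(i, j, k). i \<in> Basis \<and> j \<in> Basis \<and> i \<noteq> j \<and> k \<in> {- int m..int m}}"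

definition grid_normal :: "nat \<Rightarrow> 'a::euclidean_space \<times> 'a \<times> int \<Rightarrow> 'a" where
  "grid_normal m = (\<lambda>(i, j, k). i - (of_int k / of_nat m) *\<^sub>R j)"

lemma grid_indices_card:
  "finite (grid_indices m :: ('a::euclidean_space \<times> 'a \<times> int) set)"
  "card (grid_indices m :: ('a \<times> 'a \<times> int) set) \<le> DIM('a)\<^sup>2 * (2 * m + 1)"
proof -
  let ?X = "(Basis :: 'a set) \<times> (Basis :: 'a set) \<times> {- int m..int m}"
  have sub: "(grid_indices m :: ('a \<times> 'a \<times> int) set) \<subseteq> ?X" by (auto simp: grid_indices_def)
  have fin: "finite ?X" by simp
  show "finite (grid_indices m :: ('a \<times> 'a \<times> int) set)" using finite_subset[OF sub fin] .
  have "card {- int m..int m} = 2 * m + 1" by simp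
  hence "card ?X = DIM('a)\<^sup>2 * (2 * m + 1)"
    by (simp only: card_cartesian_product power2_eq_square mult.assoc)
  thus "card (grid_indices m :: ('a \<times> 'a \<times> int) set) \<le> DIM('a)\<^sup>2 * (2 * m + 1)"
    using card_mono[OF fin sub] by simp
qed

lemma grid_normal_nonzero:
  assumes "t \<in> grid_indices m"
  shows "grid_normal m t \<noteq> 0"
proof -
  obtain i j k where t: "t = (i, j, k)" "i \<in> Basis" "j \<in> Basis" "i \<noteq> j"
    using assms by (auto simp: grid_indices_def)
  hence "grid_normal m t \<bullet> i = 1" by (simp add: grid_normal_def inner_diff_left inner_Basis)
  thus ?thesis by auto
qed

text \<open>The grid includes the end points \<open>\<plusminus> 1\<close>, so \<open>a\<close> lies strictly between two consecutive grid points, and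
  \<open>b\<close> lies on the same sides of them.\<close>

lemma abs_diff_le_if_same_grid_interval:
  fixes a b :: real
  assumes m: "0 < m" and a: "\<bar>a\<bar> \<le> 1"
    and side: "\<And>k :: int. \<bar>k\<bar> \<le> int m \<Longrightarrow> 0 < (b - of_int k / of_nat m) * (a - of_int k / of_nat m)"
  shows "\<bar>a - b\<bar> \<le> 1 / m"
proof -
  define k where "k = \<lfloor>m * a\<rfloor>"
  have "a \<noteq> 1" using side[of "int m"] m by auto
  hence a1: "a < 1" using a by auto
  have ma: "- real m \<le> m * a" "m * a < m" using a a1 m mult_left_mono[of "-1" a "real m"] by auto
  have k: "of_int k \<le> m * a" "m * a < of_int k + 1" unfolding k_def by linarith+
  have kr: "- int m \<le> k" "k < int m"
    using ma unfolding k_def by (auto simp: le_floor_iff floor_less_iff)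
  have ka: "of_int k / m \<le> a" "a < of_int (k + 1) / m"
    using k m by (auto simp: field_simps)
  have "0 < (b - of_int k / m) * (a - of_int k / m)"
    "0 < (b - of_int (k + 1) / m) * (a - of_int (k + 1) / m)"
    using side[of k] side[of "k + 1"] kr by auto
  hence "of_int k / m < b" "b < of_int (k + 1) / m"
    using ka by (auto simp: zero_less_mult_iff)
  moreover have "of_int (k + 1) / real m = of_int k / m + 1 / m" by (simp add: add_divide_distrib)
  ultimately show ?thesis using ka by linarith
qed

text \<open>Let \<open>j\<close> be the largest coordinate of \<open>p\<close> in absolute value.  Rescaled to have \<open>j\<close>-th coordinate \<open>1\<close>,
  the points \<open>p\<close> and \<open>x\<close> become \<open>P\<close> and \<open>Q\<close>, whose other coordinates lie in common grid intervals.
  Their squared distance is therefore at most \<open>(d - 1) / m\<^sup>2\<close>.\<close>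

lemma grid_cell_angle:
  fixes p x :: "'a::euclidean_space"
  assumes d: "2 \<le> DIM('a)" and m: "0 < m" and e: "(real DIM('a) - 1) / (real m)\<^sup>2 \<le> e" "e \<le> 1"
    and p: "norm p = 1" and x: "x \<in> chamber (grid_normal m) (grid_indices m) p"
  shows "0 \<le> p \<bullet> x" "1 - e \<le> (p \<bullet> x)\<^sup>2"
proof -
  have nx: "norm x = 1" using x by (simp add: chamber_def)
  have side: "0 < (x \<bullet> i - of_int k / m * (x \<bullet> j)) * (p \<bullet> i - of_int k / m * (p \<bullet> j))"
    if "i \<in> Basis" "j \<in> Basis" "i \<noteq> j" "\<bar>k\<bar> \<le> int m" for i j k
  proof -
    have "(i, j, k) \<in> grid_indices m" using that by (auto simp: grid_indices_def)
    hence "0 < (grid_normal m (i, j, k) \<bullet> x) * (grid_normal m (i, j, k) \<bullet> p)"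
      using x by (auto simp: chamber_def)
    thus ?thesis by (simp add: grid_normal_def inner_diff_left inner_diff_right inner_commute[of x] inner_commute[of p])
  qed
  have "Max ((\<lambda>i. \<bar>p \<bullet> i\<bar>) ` Basis) \<in> (\<lambda>i. \<bar>p \<bullet> i\<bar>) ` Basis" by (intro Max_in) auto
  then obtain j where j: "j \<in> Basis" "Max ((\<lambda>i. \<bar>p \<bullet> i\<bar>) ` Basis) = \<bar>p \<bullet> j\<bar>" by blast
  have max: "\<bar>p \<bullet> i\<bar> \<le> \<bar>p \<bullet> j\<bar>" if "i \<in> Basis" for i
    using that Max_ge[of "(\<lambda>i. \<bar>p \<bullet> i\<bar>) ` Basis" "\<bar>p \<bullet> i\<bar>"] by (simp add: j(2)[symmetric])
  obtain j' :: 'a where "j' \<in> Basis" "j \<noteq> j'"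
    using d by (metis One_nat_def card_le_Suc0_iff_eq finite_Basis not_less_eq_eq numeral_2_eq_2)
  \<comment> \<open>The hyperplane \<open>x \<bullet> j = 0\<close> belongs to the grid, with \<open>k = 0\<close>.\<close>
  hence xpj: "0 < (x \<bullet> j) * (p \<bullet> j)" using side[of j j' 0] j by simp
  hence nz: "x \<bullet> j \<noteq> 0" "p \<bullet> j \<noteq> 0" by auto
  define P where "P = p /\<^sub>R (p \<bullet> j)"
  define Q where "Q = x /\<^sub>R (x \<bullet> j)"
  have close: "\<bar>P \<bullet> i - Q \<bullet> i\<bar> \<le> 1 / m" if i: "i \<in> Basis" "i \<noteq> j" for i
  proof (rule abs_diff_le_if_same_grid_interval[OF m])
    have "\<bar>P \<bullet> i\<bar> = \<bar>p \<bullet> i\<bar> / \<bar>p \<bullet> j\<bar>" by (simp add: P_def abs_mult divide_inverse mult.commute)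
    thus "\<bar>P \<bullet> i\<bar> \<le> 1" using max[OF i(1)] nz by (simp add: divide_le_eq)
    fix k :: int assume k: "\<bar>k\<bar> \<le> int m"
    have "(Q \<bullet> i - of_int k / m) * (P \<bullet> i - of_int k / m) =
      ((x \<bullet> i - of_int k / m * (x \<bullet> j)) * (p \<bullet> i - of_int k / m * (p \<bullet> j))) / ((x \<bullet> j) * (p \<bullet> j))"
      using nz by (simp add: P_def Q_def divide_inverse algebra_simps)
    thus "0 < (Q \<bullet> i - of_int k / m) * (P \<bullet> i - of_int k / m)"
      using side[OF i(1) j(1) i(2) k] xpj by simp
  qed
  have Pj: "P \<bullet> j = 1" "Q \<bullet> j = 1" using nz by (auto simp: P_def Q_def)
  have big: "1 \<le> y \<bullet> y" if "y \<bullet> j = 1" for y :: 'a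
  proof -
    have "\<bar>y \<bullet> j\<bar> \<le> norm y" using j(1) by (rule Basis_le_norm)
    hence "1 \<le> (norm y)\<^sup>2" using that by simp
    thus ?thesis by (simp add: power2_norm_eq_inner)
  qed
  have "(Q - P) \<bullet> (Q - P) = (\<Sum>i\<in>Basis. ((Q - P) \<bullet> i)\<^sup>2)"
    by (subst euclidean_inner) (simp add: power2_eq_square)
  also have "\<dots> = (\<Sum>i\<in>Basis - {j}. ((Q - P) \<bullet> i)\<^sup>2)"
    using j(1) Pj by (subst sum.remove[of _ j]) (auto simp: inner_diff_left)
  also have "\<dots> \<le> (\<Sum>i\<in>Basis - {j}. (1 / m)\<^sup>2)"
  proof (rule sum_mono)
    fix i assume "i \<in> Basis - {j}"
    hence "\<bar>(Q - P) \<bullet> i\<bar> \<le> 1 / m" using close[of i] by (simp add: inner_diff_left abs_minus_commute)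
    thus "((Q - P) \<bullet> i)\<^sup>2 \<le> (1 / m)\<^sup>2" by (simp add: power2_le_iff_abs_le)
  qed
  also have "\<dots> = (real DIM('a) - 1) / (real m)\<^sup>2"
    using j(1) DIM_positive[where 'a='a]
    by (simp add: card_Diff_singleton of_nat_diff Suc_leI power_divide)
  finally have PQ: "(Q - P) \<bullet> (Q - P) \<le> e" using e(1) by linarith
  note close = inner_squared_ge_if_close[OF big[OF Pj(1)] big[OF Pj(2)] PQ]
  define t where "t = (x \<bullet> j) * (p \<bullet> j)"
  have "p = (p \<bullet> j) *\<^sub>R P" "x = (x \<bullet> j) *\<^sub>R Q" using nz by (auto simp: P_def Q_def)
  hence px: "p \<bullet> x = t * (P \<bullet> Q)" and pp: "p \<bullet> p = (p \<bullet> j)\<^sup>2 * (P \<bullet> P)" and xx: "x \<bullet> x = (x \<bullet> j)\<^sup>2 * (Q \<bullet> Q)"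
    unfolding t_def power2_eq_square by (metis inner_scaleR_left inner_scaleR_right mult.assoc mult.commute)+
  show "0 \<le> p \<bullet> x" using px xpj close(2) e(2) by (simp add: t_def)
  have "p \<bullet> p = 1" "x \<bullet> x = 1" using p nx by (simp_all add: dot_square_norm)
  hence "1 = ((p \<bullet> j)\<^sup>2 * (P \<bullet> P)) * ((x \<bullet> j)\<^sup>2 * (Q \<bullet> Q))" using pp xx by simp
  also have "\<dots> = t\<^sup>2 * ((P \<bullet> P) * (Q \<bullet> Q))" by (simp add: t_def power_mult_distrib mult_ac)
  finally have "1 - e = t\<^sup>2 * ((1 - e) * ((P \<bullet> P) * (Q \<bullet> Q)))" by (metis mult.left_commute mult.right_neutral)
  also have "\<dots> \<le> t\<^sup>2 * (P \<bullet> Q)\<^sup>2" using close(1) by (intro mult_left_mono) auto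
  finally show "1 - e \<le> (p \<bullet> x)\<^sup>2" by (simp add: px power_mult_distrib)
qed

text \<open>Each point of a cell serves as the centre of a cap that covers the cell.\<close>

lemma cells_covered_grid:
  assumes d: "2 \<le> DIM('a::euclidean_space)" and m: "0 < m"
    and \<rho>: "0 \<le> \<rho>" "\<rho> \<le> 1" "(real DIM('a) - 1) / (real m)\<^sup>2 \<le> \<rho>\<^sup>2"
  shows "cells_covered ((\<lambda>t. equator (grid_normal m t)) ` (grid_indices m :: ('a \<times> 'a \<times> int) set)) (arcsin \<rho>)"
proof -
  obtain a b :: 'a where ab: "a \<in> Basis" "b \<in> Basis" "a \<noteq> b"
    using d by (metis One_nat_def card_le_Suc0_iff_eq finite_Basis not_less_eq_eq numeral_2_eq_2)
  hence "(a, b, 0) \<in> grid_indices m" by (simp add: grid_indices_def)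
  hence ne: "(grid_indices m :: ('a \<times> 'a \<times> int) set) \<noteq> {}" by blast
  show ?thesis
    unfolding cells_covered_iff[OF ne]
  proof (intro allI impI exI conjI ballI)
    fix p x :: 'a
    assume p: "norm p = 1 \<and> (\<forall>t\<in>grid_indices m. grid_normal m t \<bullet> p \<noteq> 0)"
      and x: "x \<in> chamber (grid_normal m) (grid_indices m) p"
    have "\<rho>\<^sup>2 \<le> 1" using \<rho> by (simp add: power_le_one)
    note angle = grid_cell_angle[OF d m \<rho>(3) this _ x]
    have "sqrt (1 - \<rho>\<^sup>2) \<le> p \<bullet> x" using angle p by (intro real_le_lsqrt) auto
    thus "cos (arcsin \<rho>) \<le> p \<bullet> x" using \<rho> by (simp add: cos_arcsin)
  qed simp
qed

lemma cubic_le_power4: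
  fixes d :: nat
  assumes "3 \<le> d"
  shows "d\<^sup>2 * (d + 20) \<le> 4 ^ (d + 1)"
  using assms
proof (induction d rule: dec_induct)
  case (step d)
  have "(Suc d)\<^sup>2 * (Suc d + 20) \<le> (2 * d\<^sup>2) * (2 * (d + 20))"
  proof (rule mult_mono)
    have "3 * d \<le> d * d" using step by (intro mult_right_mono) auto
    hence "Suc (d + d) \<le> d * d" using step by linarith
    thus "(Suc d)\<^sup>2 \<le> 2 * d\<^sup>2" using step by (simp add: power2_eq_square)
  qed auto
  also have "\<dots> = 4 * (d\<^sup>2 * (d + 20))" by simp
  also have "\<dots> \<le> 4 * 4 ^ (d + 1)" using step by simp
  finally show ?case by simp
qed simp

text \<open>The mesh is the coarsest one for which the cells are small enough: with \<open>s = root d n\<close>, the first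
  condition reads \<open>d * s\<^sup>2 / 32 \<le> m\<^sup>2\<close>.  The grid then has \<open>O(d\<^sup>2 * sqrt d * s)\<close> hyperplanes, far fewer
  than \<open>n = s ^ d\<close>.  The assumption \<open>\<rho> \<le> 1\<close> forces \<open>4 \<le> s\<close>, which turns this into the polynomial
  inequality \<open>cubic_le_power4\<close>.\<close>

lemma grid_resolution_exists:
  fixes d n :: nat
  defines "\<rho> \<equiv> 4 / root d n * sqrt ((2 * real d - 2) / d)"
  assumes d: "3 \<le> d" and n: "0 < n" and \<rho>: "\<rho> \<le> 1"
  shows "0 < \<rho>" and "\<exists>m>0. (real d - 1) / (real m)\<^sup>2 \<le> \<rho>\<^sup>2 \<and> d\<^sup>2 * (2 * m + 1) \<le> n"
proof -
  define s where "s = root d n"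
  have s0: "0 < s" and sd: "s ^ d = n" using d n by (auto simp: s_def)
  have sq: "1 \<le> (2 * real d - 2) / d" using d by (simp add: field_simps)
  hence "1 \<le> sqrt ((2 * real d - 2) / d)" by simp
  moreover have \<rho>s: "\<rho> = 4 * sqrt ((2 * real d - 2) / d) / s" by (simp add: \<rho>_def s_def)
  ultimately show "0 < \<rho>" using s0 by simp
  have s4: "4 \<le> s"
  proof -
    have "4 * sqrt ((2 * real d - 2) / d) \<le> s" using \<rho> s0 by (simp add: \<rho>s)
    thus ?thesis using \<open>1 \<le> sqrt ((2 * real d - 2) / d)\<close> by linarith
  qed
  define y where "y = sqrt (real d / 32) * s"
  define m where "m = nat \<lceil>y\<rceil>"
  have y0: "0 < y" using d s0 by (simp add: y_def)
  have m: "y \<le> m" "m \<le> y + 1" using y0 by (simp_all add: m_def)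
  have m0: "0 < m" using m y0 by simp
  have "real d * s\<^sup>2 / 32 = y\<^sup>2" by (simp add: y_def power_mult_distrib)
  also have "\<dots> \<le> (real m)\<^sup>2" using m y0 by (intro power_mono) auto
  finally have "(real d - 1) / (real m)\<^sup>2 \<le> (real d - 1) / (real d * s\<^sup>2 / 32)"
    using d s0 m0 by (intro divide_left_mono) auto
  also have "\<dots> = \<rho>\<^sup>2" using d s0 by (simp add: \<rho>s power_mult_distrib power_divide field_simps)
  finally have 1: "(real d - 1) / (real m)\<^sup>2 \<le> \<rho>\<^sup>2" .
  \<comment> \<open>The arithmetic-geometric mean inequality for \<open>d\<close> and \<open>8\<close>.\<close>
  have "sqrt (real d / 32) \<le> (real d + 8) / 32"
  proof (rule real_le_lsqrt)
    have "0 \<le> (real d - 8)\<^sup>2" by simp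
    thus "real d / 32 \<le> ((real d + 8) / 32)\<^sup>2" by (simp add: power2_eq_square field_simps)
  qed auto
  hence "y \<le> (real d + 8) / 32 * s" unfolding y_def using s0 by (intro mult_right_mono) auto
  hence "2 * real m + 1 \<le> (real d + 20) / 16 * s" using m(2) s4 by (simp add: algebra_simps)
  hence "(real d)\<^sup>2 * (2 * real m + 1) \<le> (real d)\<^sup>2 * ((real d + 20) / 16 * s)"
    by (intro mult_left_mono) auto
  also have "\<dots> = real (d\<^sup>2 * (d + 20)) / 16 * s" by simp
  also have "\<dots> \<le> real (4 ^ (d + 1)) / 16 * s"
  proof (intro mult_right_mono divide_right_mono)
    show "real (d\<^sup>2 * (d + 20)) \<le> real (4 ^ (d + 1))"
      using cubic_le_power4[OF d] by (simp only: of_nat_le_iff)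
  qed (use s0 in simp_all)
  also have "\<dots> = 4 ^ (d - 1) * s" using d by (cases d) auto
  also have "\<dots> \<le> s ^ (d - 1) * s" using s4 by (intro mult_right_mono power_mono) auto
  also have "\<dots> = n" using d sd by (cases d) (auto simp: mult.commute)
  finally have "real (d\<^sup>2 * (2 * m + 1)) \<le> real n" by (simp add: distrib_left)
  hence "d\<^sup>2 * (2 * m + 1) \<le> n" by (simp only: of_nat_le_iff)
  thus "\<exists>m>0. (real d - 1) / (real m)\<^sup>2 \<le> \<rho>\<^sup>2 \<and> d\<^sup>2 * (2 * m + 1) \<le> n" using 1 m0 by blast
qed

section \<open>Numerical estimates\<close>

lemma abs_sin_nat_mult_le: "\<bar>sin (real k * x)\<bar> \<le> real k * \<bar>sin x\<bar>"
proof (induction k)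
  case (Suc k)
  have "\<bar>sin (real (Suc k) * x)\<bar> = \<bar>sin (real k * x) * cos x + cos (real k * x) * sin x\<bar>"
    by (simp add: sin_add algebra_simps)
  also have "\<dots> \<le> \<bar>sin (real k * x)\<bar> * \<bar>cos x\<bar> + \<bar>cos (real k * x)\<bar> * \<bar>sin x\<bar>"
    by (metis abs_mult abs_triangle_ineq)
  also have "\<dots> \<le> \<bar>sin (real k * x)\<bar> * 1 + 1 * \<bar>sin x\<bar>"
    by (intro add_mono mult_left_mono mult_right_mono) auto
  also have "\<dots> \<le> real (Suc k) * \<bar>sin x\<bar>" using Suc by (simp add: distrib_right)
  finally show ?case .
qed simp

text \<open>The estimate \<open>1 / (n + 1) \<le> sin (pi / (2 * (n + 1)))\<close> follows from \<open>sin (k * x) \<le> k * sin x\<close> at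
  \<open>k = n + 1\<close>, where the left-hand side is \<open>sin (pi / 2)\<close>.\<close>

lemma arcsin_inverse_le: "arcsin (1 / (real n + 1)) \<le> pi / (2 * (real n + 1))"
proof -
  let ?x = "pi / (2 * (real n + 1))"
  have x: "0 \<le> ?x" "?x \<le> pi / 2" by (simp_all add: field_simps)
  have "real (n + 1) * ?x = pi / 2" by (simp add: field_simps)
  hence "1 = \<bar>sin (real (n + 1) * ?x)\<bar>" by (simp only: sin_pi_half abs_one)
  also have "\<dots> \<le> real (n + 1) * \<bar>sin ?x\<bar>" by (rule abs_sin_nat_mult_le)
  also have "\<bar>sin ?x\<bar> = sin ?x" using x pi_gt_zero by (intro abs_of_nonneg sin_ge_zero) linarith+
  finally have "1 / (real n + 1) \<le> sin ?x" by (simp add: field_simps)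
  hence "arcsin (1 / (real n + 1)) \<le> arcsin (sin ?x)"
    by (intro arcsin_le_arcsin) (auto intro: order.trans[of _ 0])
  also have "\<dots> = ?x" using x pi_gt_zero by (intro arcsin_sin) linarith+
  finally show ?thesis .
qed

text \<open>The terms up to \<open>i = 3\<close> suffice.  For \<open>n = k + 3\<close> the first three, doubled, give \<open>k\<^sup>2 + 5 * k + 8\<close>,
  while the left-hand side is at most \<open>k\<^sup>2 + 6 * k + 8\<close>; the cubic term, which occurs because \<open>3 < d\<close>,
  makes up for the missing \<open>k\<close> by contributing at least \<open>2 * k\<close>.\<close>

lemma dimension_mult_less_cell_bound:
  fixes d n :: nat
  assumes d: "3 < d" and n: "d < n"
  shows "real d * (real n + 1) < 2 * (\<Sum>i = 0..d - 1. real ((n - 1) choose i))"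
proof -
  obtain k where k: "n = k + 3" using d n by (metis add.commute le_add_diff_inverse less_imp_le_nat order.strict_trans)
  have k2: "2 \<le> k" using k d n by simp
  have C3: "k \<le> Suc (Suc k) choose 3" by (simp add: numeral_3_eq_3 numeral_2_eq_2)
  define c where "c = Suc (Suc k) choose 2"
  have "2 * c = Suc (Suc k) * Suc k"
    unfolding c_def choose_two by simp
  hence "real (2 * c) = real (Suc (Suc k) * Suc k)" by (rule arg_cong)
  hence C2: "2 * real c = (real k + 2) * (real k + 1)" by (simp add: algebra_simps)
  have "real d * (real n + 1) \<le> (real k + 2) * (real k + 4)"
    using n k by (intro mult_mono) auto
  also have "\<dots> < 2 * (1 + (real k + 2) + real k) + 2 * real c"
    unfolding C2 using k2 by (simp add: algebra_simps)
  also have "\<dots> \<le> 2 * (1 + (real k + 2) + real c + real (Suc (Suc k) choose 3))"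
    using C3 by simp
  also have "\<dots> = 2 * (\<Sum>i = 0..3. real ((n - 1) choose i))"
    using k by (simp add: c_def numeral_3_eq_3 numeral_2_eq_2)
  also have "\<dots> \<le> 2 * (\<Sum>i = 0..d - 1. real ((n - 1) choose i))"
    using d by (intro mult_left_mono sum_mono2) auto
  finally show ?thesis .
qed

section \<open>The minimal radii\<close>

lemma cos_arccos_inverse_sqrt:
  assumes "0 < d"
  shows "cos (arccos (1 / sqrt (real d))) = 1 / sqrt (real d)"
  using assms by (intro cos_arccos) (auto intro: order.trans[of _ 0])

lemma arccos_inverse_sqrt_bounds:
  assumes "1 < d"
  shows "0 < arccos (1 / sqrt (real d))" "arccos (1 / sqrt (real d)) \<le> pi / 2"
proof -
  have "1 / sqrt (real d) < 1" using assms by simp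
  thus "0 < arccos (1 / sqrt (real d))" by (intro arccos_lt_bounded[THEN conjunct1]) (auto intro: less_le_trans[of _ 0])
  show "arccos (1 / sqrt (real d)) \<le> pi / 2" using assms by (intro arccos_le_pi2) auto
qed

lemma R_gs_dimension:
  assumes d: "2 \<le> DIM('a::euclidean_space)"
  shows "R_gs TYPE('a) (DIM('a)) = arccos (1 / sqrt (real (DIM('a))))"
proof (rule antisym)
  let ?r = "arccos (1 / sqrt (real (DIM('a))))"
  have "?r \<in> covering_radii TYPE('a) (DIM('a))"
  proof (rule covering_radiiI[OF d, of "Basis" _ "\<lambda>b. b"])
    show "cells_covered ((\<lambda>b. equator b) ` (Basis :: 'a set)) ?r"
      by (rule cells_covered_if_orthogonal_normals) (auto simp: inner_Basis)
  qed (use d arccos_inverse_sqrt_bounds[of "DIM('a)"] in auto)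
  thus "R_gs TYPE('a) (DIM('a)) \<le> ?r" using d by (intro least_covering_radius(2)) auto
  define R where "R = R_gs TYPE('a) (DIM('a))"
  obtain \<A> :: "'a set set" where A: "gs_arrangement (DIM('a)) \<A>" "cells_covered \<A> R" and R: "0 < R" "R \<le> pi / 2"
    using least_covering_radius(1)[OF d, of "DIM('a)"] d by (auto simp: covering_radii_def R_def)
  obtain u where u: "\<And>i. i < DIM('a) \<Longrightarrow> norm (u i) = 1" "(\<lambda>i. equator (u i)) ` {..<DIM('a)} = \<A>"
    using gs_arrangement_indexed_normals[OF d A(1)] by blast
  have u0: "u i \<noteq> 0" if "i \<in> {..<DIM('a)}" for i using u(1)[of i] that by auto
  show "?r \<le> R"
  proof (cases "0 < cos R")
    case True
    have "DIM('a) * (cos R)\<^sup>2 \<le> 1"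
      by (rule cos_cap_radius_simplices_le[where I = "{..<DIM('a)}" and u = u, OF _ _ _ u0 _ True])
        (use A u d in \<open>simp_all add: lessThan_empty_iff\<close>)
    hence "(cos R)\<^sup>2 \<le> (1 / sqrt (DIM('a)))\<^sup>2" using d by (simp add: power_divide field_simps)
    hence "cos R \<le> 1 / sqrt (DIM('a))" by (rule power2_le_imp_le) simp
    hence "cos R \<le> cos ?r" using d by (subst cos_arccos_inverse_sqrt) auto
    thus ?thesis using R arccos_inverse_sqrt_bounds[of "DIM('a)"] d by (subst (asm) cos_mono_le_eq) auto
  next
    case False
    hence "pi / 2 \<le> R" using R cos_gt_zero[of R] by force
    thus ?thesis using arccos_inverse_sqrt_bounds[of "DIM('a)"] d by auto
  qed
qed

lemma gs_extremal_dimension_iff: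
  fixes \<A> :: "'a::euclidean_space set set"
  assumes d: "2 \<le> DIM('a)" and A: "gs_arrangement (DIM('a)) \<A>"
  shows "gs_extremal (DIM('a)) \<A> \<longleftrightarrow> pairwise orthogonal_great_spheres \<A>"
proof -
  let ?r = "arccos (1 / sqrt (real (DIM('a))))"
  obtain u where u: "\<And>G. G \<in> \<A> \<Longrightarrow> norm (u G) = 1" "\<And>G. G \<in> \<A> \<Longrightarrow> equator (u G) = G"
    using gs_arrangement_normals[OF d A] by metis
  have u0: "u G \<noteq> 0" if "G \<in> \<A>" for G using u(1)[OF that] by auto
  have A': "finite \<A>" "card \<A> = DIM('a)" "\<A> \<noteq> {}" using A d by (auto simp: gs_arrangement_def)
  have eqA: "(\<lambda>G. equator (u G)) ` \<A> = \<A>" using u(2) by simp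
  have cosr: "cos ?r = 1 / sqrt (DIM('a))" using d by (intro cos_arccos_inverse_sqrt) auto
  have "pairwise orthogonal_great_spheres \<A> \<longleftrightarrow> (\<forall>G\<in>\<A>. \<forall>H\<in>\<A>. G \<noteq> H \<longrightarrow> u G \<bullet> u H = 0)"
  proof -
    have "orthogonal_great_spheres G H \<longleftrightarrow> u G \<bullet> u H = 0" if "G \<in> \<A>" "H \<in> \<A>" for G H
      using orthogonal_equators_iff[OF u(1)[OF that(1)] u(1)[OF that(2)]] by (simp only: u(2) that)
    thus ?thesis unfolding pairwise_def by blast
  qed
  also have "\<dots> \<longleftrightarrow> cells_covered \<A> ?r"
  proof
    assume orth: "\<forall>G\<in>\<A>. \<forall>H\<in>\<A>. G \<noteq> H \<longrightarrow> u G \<bullet> u H = 0"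
    have "cells_covered ((\<lambda>G. equator (u G)) ` \<A>) ?r"
      by (rule cells_covered_if_orthogonal_normals[OF A' u(1)]) (use orth in blast)+
    thus "cells_covered \<A> ?r" unfolding eqA .
  next
    assume cov: "cells_covered \<A> ?r"
    show "\<forall>G\<in>\<A>. \<forall>H\<in>\<A>. G \<noteq> H \<longrightarrow> u G \<bullet> u H = 0"
    proof (intro ballI impI)
      fix G H assume GH: "G \<in> \<A>" "H \<in> \<A>" "G \<noteq> H"
      have cov': "cells_covered ((\<lambda>G. equator (u G)) ` \<A>) ?r" unfolding eqA by (rule cov)
      have pos: "0 < cos ?r" unfolding cosr by simp
      have ext: "DIM('a) * (cos ?r)\<^sup>2 = 1" unfolding cosr by (simp add: power_divide)
      show "u G \<bullet> u H = 0"
        by (rule orthogonal_normals_if_extremal[OF A' u0 cov' pos ext GH])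
    qed
  qed
  finally show ?thesis using A by (simp add: gs_extremal_def R_gs_dimension[OF d])
qed

lemma R_gs_gt:
  assumes d: "3 < DIM('a::euclidean_space)" and n: "DIM('a) < n"
  shows "arcsin (real (DIM('a)) / (2 * (\<Sum>i = 0..DIM('a) - 1. real ((n - 1) choose i)))) < R_gs TYPE('a) n"
proof -
  define N where "N = 2 * (\<Sum>i = 0..DIM('a) - 1. real ((n - 1) choose i))"
  have N: "real (DIM('a)) * (real n + 1) < N" unfolding N_def by (rule dimension_mult_less_cell_bound[OF d n])
  have N0: "0 < N" using N by (rule le_less_trans[rotated]) simp
  have "real (DIM('a)) / N < 1 / (real n + 1)" using N N0 by (simp add: field_simps)
  moreover have "0 \<le> real (DIM('a)) / N" using N0 by simp
  ultimately have "arcsin (real (DIM('a)) / N) < arcsin (1 / (real n + 1))"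
    by (intro arcsin_less_arcsin) simp_all
  also have "\<dots> \<le> pi / (2 * (real n + 1))" by (rule arcsin_inverse_le)
  also have "\<dots> \<le> R_gs TYPE('a) n"
  proof -
    obtain \<A> :: "'a set set" where "gs_arrangement n \<A>" "cells_covered \<A> (R_gs TYPE('a) n)"
      "0 < R_gs TYPE('a) n" "R_gs TYPE('a) n \<le> pi / 2"
      using least_covering_radius(1)[where 'a='a, of n] d n by (auto simp: covering_radii_def)
    thus ?thesis using d n by (intro cap_radius_lower_bound[OF _ _ \<open>gs_arrangement n \<A>\<close>]) simp_all
  qed
  finally show ?thesis unfolding N_def .
qed

lemma R_gs_le:
  assumes d: "3 \<le> DIM('a::euclidean_space)" and n: "0 < n"
  shows "R_gs TYPE('a) n \<le> arcsin (min 1 (4 / root (DIM('a)) (real n)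
                            * sqrt ((2 * real (DIM('a)) - 2) / real (DIM('a)))))"
proof -
  define \<rho> where "\<rho> = 4 / root (DIM('a)) (real n) * sqrt ((2 * real (DIM('a)) - 2) / real (DIM('a)))"
  have d2: "2 \<le> DIM('a)" using d by simp
  have "arcsin (min 1 \<rho>) \<in> covering_radii TYPE('a) n"
  proof (cases "\<rho> \<le> 1")
    case True
    obtain m where m: "0 < m" "(real DIM('a) - 1) / (real m)\<^sup>2 \<le> \<rho>\<^sup>2" "DIM('a)\<^sup>2 * (2 * m + 1) \<le> n"
      using grid_resolution_exists(2)[OF d n] True unfolding \<rho>_def by blast
    have \<rho>0: "0 < \<rho>" using grid_resolution_exists(1)[OF d n] True unfolding \<rho>_def by blast
    have "arcsin \<rho> \<in> covering_radii TYPE('a) n"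
    proof (rule covering_radiiI[OF d2 grid_indices_card(1)])
      show "cells_covered ((\<lambda>t. equator (grid_normal m t)) ` (grid_indices m :: ('a \<times> 'a \<times> int) set)) (arcsin \<rho>)"
        using \<rho>0 True m by (intro cells_covered_grid d2) auto
      show "card (grid_indices m :: ('a \<times> 'a \<times> int) set) \<le> n"
        using grid_indices_card(2)[of m, where 'a='a] m(3) by linarith
      show "0 < arcsin \<rho>" using \<rho>0 True arcsin_less_arcsin[of 0 \<rho>] by simp
      show "arcsin \<rho> \<le> pi / 2" using arcsin_le_arcsin[of \<rho> 1] \<rho>0 True by simp
    qed (rule grid_normal_nonzero)
    thus ?thesis using True by (simp add: min_def)
  next
    case False
    thus ?thesis using right_angle_mem_covering_radii[OF d2 n] by (simp add: min_def)
  qed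
  thus ?thesis unfolding \<rho>_def by (rule least_covering_radius(2)[OF d2 n])
qed

theorem theorem7:
  shows "(DIM('a::euclidean_space) \<ge> 3 \<longrightarrow>
       R_gs TYPE('a) (DIM('a)) = arccos (1 / sqrt (real (DIM('a)))) \<and>
       (\<forall>\<A> :: 'a set set. gs_arrangement (DIM('a)) \<A> \<longrightarrow>
          (gs_extremal (DIM('a)) \<A> \<longleftrightarrow> pairwise orthogonal_great_spheres \<A>))) \<and>
    (\<forall>n. n > DIM('a) \<and> DIM('a) > 3 \<longrightarrow>
       arcsin (real (DIM('a)) / (2 * (\<Sum>i = 0..DIM('a) - 1. real ((n - 1) choose i))))
         < R_gs TYPE('a) n) \<and>
    (\<forall>n. n > DIM('a) \<and> DIM('a) \<ge> 3 \<longrightarrow>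
       R_gs TYPE('a) n
         \<le> arcsin (min 1 (4 / root (DIM('a)) (real n)
                            * sqrt ((2 * real (DIM('a)) - 2) / real (DIM('a))))))"
proof (intro conjI allI impI)
  assume "3 \<le> DIM('a)"
  hence d: "2 \<le> DIM('a)" by simp
  show "R_gs TYPE('a) (DIM('a)) = arccos (1 / sqrt (real (DIM('a))))"
    by (rule R_gs_dimension[OF d])
  show "gs_extremal (DIM('a)) \<A> \<longleftrightarrow> pairwise orthogonal_great_spheres \<A>"
    if "gs_arrangement (DIM('a)) \<A>" for \<A> :: "'a set set"
    by (rule gs_extremal_dimension_iff[OF d that])
next
  fix n assume "n > DIM('a) \<and> DIM('a) > 3"
  thus "arcsin (real (DIM('a)) / (2 * (\<Sum>i = 0..DIM('a) - 1. real ((n - 1) choose i))))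
         < R_gs TYPE('a) n"
    using R_gs_gt by blast
next
  fix n assume "n > DIM('a) \<and> DIM('a) \<ge> 3"
  hence "3 \<le> DIM('a)" "0 < n" by simp_all
  thus "R_gs TYPE('a) n
         \<le> arcsin (min 1 (4 / root (DIM('a)) (real n)
                            * sqrt ((2 * real (DIM('a)) - 2) / real (DIM('a)))))"
    by (rule R_gs_le)
qed

end
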